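(* Let $\phi:(\mathbb{P}^1)^3\dashrightarrow\mathbb{P}^3$ be a pyramidal trilinear rational map (with $Y_0,Y_1$ the quadric boundary surfaces). Then $\phi$ is birational of type $(1,1,2)$ if and only if $$w_{ijk}=\alpha_i\,\beta_j\,\gamma_k\,\Delta_{ijk}\qquad(0\le i,j,k\le1)$$ for some $(\alpha_0:\alpha_1)\times(\beta_0:\beta_1)\times(\gamma_0:\gamma_1)$ in $(\mathbb{P}^1_{\mathbb{R}})^3$.
   Context: Setting. $\mathbb{P}^n$ is complex and $\mathbb{P}^n_{\mathbb{R}}$ real projective $n$-space. $\phi:\mathbb{P}^1\times\mathbb{P}^1\times\mathbb{P}^1\dashrightarrow\mathbb{P}^3$ is the trilinear rational map given by $$\mathbf{f}=(f_0,f_1,f_2,f_3)=\sum_{0\le i,j,k\le 1} w_{ijk}\,\mathbf{P}_{ijk}\,s_it_ju_k,$$ with control points $\mathbf{P}_{ijk}=(1,x_{ijk},y_{ijk},z_{ijk})\in\mathbb{R}^4$ (identified with points of $\mathbb{P}^3$) and weights $w_{ijk}\in\mathbb{R}$. The weights matter only up to a common nonzero scalar, and the equality of weights is understood in this sense (equivalently, for suitable representatives of the points of $\mathbb{P}^1_{\mathbb{R}}$). Boundary surfaces. $\Sigma_0$ (resp. $\Sigma_1$) is the closure of the image of $\phi$ restricted to $(s_0:s_1)=(1:0)$ (resp. $(0:1)$). $T_0,T_1$ and $Y_0,Y_1$ are defined in the same way using $(t_0:t_1)$ and $(u_0:u_1)$. So $\mathbf{P}_{ijk}\in\Sigma_i\cap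 T_j\cap Y_k$. Boundary lines: $s_{jk}$ joins $\mathbf{P}_{0jk},\mathbf{P}_{1jk}$; $t_{ik}$ joins $\mathbf{P}_{i0k},\mathbf{P}_{i1k}$; $u_{ij}$ joins $\mathbf{P}_{ij0},\mathbf{P}_{ij1}$ (images of the corresponding coordinate lines). Each boundary surface is a plane or a quadric. Standing nondegeneracy assumption: the surfaces $\Sigma_i,T_j,Y_k$ are smooth surfaces, pairwise distinct, and $s_{jk},t_{ik},u_{ij}$ are lines, pairwise distinct. $\phi$ is pyramidal if for one of the three parameters (1) the four boundary lines intersect at a point, and (2) the two boundary surfaces are quadrics. Convention: this parameter is $u$, so the $u_{ij}$ meet at a point $\mathbf{A}$, $Y_0,Y_1$ are quadrics, and $\Sigma_i,T_j$ are planes. Let $s=\Sigma_0\cap\Sigma_1$, $t=T_0\cap T_1$, and let $\Pi_0$ be the plane through $s$ and $t$, defined by $\boldsymbol{\pi}_0\cdot\mathbf{x}^T=0$ with $\boldsymbol{\pi}_0\in\mathbb{R}^4$. Set $\Delta_{ijk}=1/\langle\boldsymbol{\pi}_0,\mathbf{P}_{ijk}\rangle$ (well defined under the standing assumption), where $\langle\cdot,\cdot\rangle$ is the usual scalar product. Type. If $\phi$ is birational, its inverse is $\mathbf{x}\mapsto(A_0:A_1)\times(B_0:B_1)\times(C_0:C_1)$ with $A_0,A_1$ (resp. $B_0,B_1$; $C_0,C_1$) homogeneous of the same degree in $\mathbf{x}=(x_0,\dots,x_3)$ without common factor; the type of $\phi$ is $(\deg A_i,\deg B_j,\deg C_k)$.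 *)

theory Defs
  imports
    "HOL-Analysis.Analysis"
    "HOL-Library.Poly_Mapping"
    "HOL-Computational_Algebra.Factorial_Ring"
begin

text \<open>
  Conventions. Points of complex projective \<open>n\<close>-space are given by nonzero vectors of homogeneous
  coordinates, and subsets of projective space by sets of nonzero vectors closed under nonzero
  scaling. The numeral types \<open>2\<close> and \<open>4\<close> serve as index types: their elements are \<open>0, 1\<close> and
  \<open>0, 1, 2, 3\<close>, so that \<open>x $ 0, x $ 1, x $ 2, x $ 3\<close> are the usual coordinates on projective 3-space.
\<close>

subsection \<open>Homogeneous polynomials and surfaces in projective 3-space\<close>

text \<open>The polynomial ring over the complex numbers in \<open>x\<^sub>0, \<dots>, x\<^sub>3\<close>; a monomial is its exponent
  vector.\<close>

type_synonym poly4 = "(4 \<Rightarrow>\<^sub>0 nat) \<Rightarrow>\<^sub>0 complex"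

definition peval :: "poly4 \<Rightarrow> complex^4 \<Rightarrow> complex" where
  "peval F x =
    (\<Sum>m\<in>Poly_Mapping.keys F.
       Poly_Mapping.lookup F m * (\<Prod>n\<in>UNIV. (x $ n) ^ Poly_Mapping.lookup m n))"

definition homogeneous :: "nat \<Rightarrow> poly4 \<Rightarrow> bool" where
  "homogeneous d F \<longleftrightarrow> (\<forall>m\<in>Poly_Mapping.keys F. (\<Sum>n\<in>UNIV. Poly_Mapping.lookup m n) = d)"

text \<open>Formal partial derivative; if \<open>x\<^sub>n\<close> does not occur in a monomial, its new coefficient is zero.\<close>

definition partial_deriv :: "4 \<Rightarrow> poly4 \<Rightarrow> poly4" where
  "partial_deriv n F =
    (\<Sum>m\<in>Poly_Mapping.keys F. Poly_Mapping.single (m - Poly_Mapping.single n 1)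
                   (of_nat (Poly_Mapping.lookup m n) * Poly_Mapping.lookup F m))"

definition zero_locus :: "poly4 \<Rightarrow> (complex^4) set" where
  "zero_locus F = {x. x \<noteq> 0 \<and> peval F x = 0}"

definition zariski_closure :: "(complex^4) set \<Rightarrow> (complex^4) set" where
  "zariski_closure X =
    {x. x \<noteq> 0 \<and> (\<forall>d F. homogeneous d F \<longrightarrow> (\<forall>y\<in>X. peval F y = 0) \<longrightarrow> peval F x = 0)}"

definition smooth_surface :: "(complex^4) set \<Rightarrow> bool" where
  "smooth_surface V \<longleftrightarrow>
    (\<exists>d F. homogeneous d F \<and> irreducible F \<and> V = zero_locus F \<and>
           (\<forall>x\<in>V. \<exists>n. peval (partial_deriv n F) x \<noteq> 0))"

definition quadric :: "(complex^4) set \<Rightarrow> bool" where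
  "quadric V \<longleftrightarrow> (\<exists>F. homogeneous 2 F \<and> irreducible F \<and> V = zero_locus F)"

definition is_line :: "(complex^4) set \<Rightarrow> bool" where
  "is_line L \<longleftrightarrow> (\<exists>W. vec.subspace W \<and> vec.dim W = 2 \<and> L = W - {0})"

definition cvec :: "real^4 \<Rightarrow> complex^4" where
  "cvec v = (\<chi> n. complex_of_real (v $ n))"

definition join :: "real^4 \<Rightarrow> real^4 \<Rightarrow> (complex^4) set" where
  "join p q = vec.span {cvec p, cvec q} - {0}"

definition plane_of :: "real^4 \<Rightarrow> (complex^4) set" where
  "plane_of p = {x. x \<noteq> 0 \<and> (\<Sum>n\<in>UNIV. cvec p $ n * x $ n) = 0}"

subsection \<open>Trilinear rational maps\<close>

text \<open>The weights are \<open>w i j k\<close>, the control points \<open>P i j k\<close>. The rational map is undefined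
  where \<open>trilinear\<close> vanishes.\<close>

definition trilinear ::
  "(2 \<Rightarrow> 2 \<Rightarrow> 2 \<Rightarrow> real) \<Rightarrow> (2 \<Rightarrow> 2 \<Rightarrow> 2 \<Rightarrow> real^4) \<Rightarrow>
   complex^2 \<Rightarrow> complex^2 \<Rightarrow> complex^2 \<Rightarrow> complex^4" where
  "trilinear w P s t u =
    (\<Sum>i\<in>UNIV. \<Sum>j\<in>UNIV. \<Sum>k\<in>UNIV.
       (complex_of_real (w i j k) * s $ i * t $ j * u $ k) *s cvec (P i j k))"

text \<open>Here \<open>axis 0 1\<close> and \<open>axis 1 1\<close> are the parameter values \<open>(1:0)\<close> and \<open>(0:1)\<close>.\<close>

definition Sigma_surf where
  "Sigma_surf w P i =
    zariski_closure {x. x \<noteq> 0 \<and> (\<exists>t u. x = trilinear w P (axis i 1) t u)}"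

definition T_surf where
  "T_surf w P j =
    zariski_closure {x. x \<noteq> 0 \<and> (\<exists>s u. x = trilinear w P s (axis j 1) u)}"

definition Y_surf where
  "Y_surf w P k =
    zariski_closure {x. x \<noteq> 0 \<and> (\<exists>s t. x = trilinear w P s t (axis k 1))}"

definition s_line :: "(2 \<Rightarrow> 2 \<Rightarrow> 2 \<Rightarrow> real^4) \<Rightarrow> 2 \<Rightarrow> 2 \<Rightarrow> (complex^4) set" where
  "s_line P j k = join (P 0 j k) (P 1 j k)"

definition t_line :: "(2 \<Rightarrow> 2 \<Rightarrow> 2 \<Rightarrow> real^4) \<Rightarrow> 2 \<Rightarrow> 2 \<Rightarrow> (complex^4) set" where
  "t_line P i k = join (P i 0 k) (P i 1 k)"

definition u_line :: "(2 \<Rightarrow> 2 \<Rightarrow> 2 \<Rightarrow> real^4) \<Rightarrow> 2 \<Rightarrow> 2 \<Rightarrow> (complex^4) set" where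
  "u_line P i j = join (P i j 0) (P i j 1)"

definition boundary_surfaces where
  "boundary_surfaces w P =
    [Sigma_surf w P 0, Sigma_surf w P 1, T_surf w P 0, T_surf w P 1, Y_surf w P 0, Y_surf w P 1]"

definition boundary_lines where
  "boundary_lines P =
    [s_line P 0 0, s_line P 0 1, s_line P 1 0, s_line P 1 1,
     t_line P 0 0, t_line P 0 1, t_line P 1 0, t_line P 1 1,
     u_line P 0 0, u_line P 0 1, u_line P 1 0, u_line P 1 1]"

definition nondegenerate where
  "nondegenerate w P \<longleftrightarrow>
    (\<forall>V\<in>set (boundary_surfaces w P). smooth_surface V) \<and> distinct (boundary_surfaces w P) \<and>
    (\<forall>L\<in>set (boundary_lines P). is_line L) \<and> distinct (boundary_lines P)"

text \<open>Pyramidal maps, normalised so that the distinguished parameter is \<open>u\<close>.\<close>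

definition pyramidal_u where
  "pyramidal_u w P \<longleftrightarrow>
    (\<exists>A. \<forall>i j. A \<in> u_line P i j) \<and> (\<forall>k. quadric (Y_surf w P k))"

subsection \<open>Birationality and type\<close>

text \<open>Two tuples of forms define the same rational map to a projective space iff neither is
  identically zero and their \<open>2 \<times> 2\<close> minors vanish identically. The following relation is the
  vanishing of the minors at one parameter value.\<close>

definition proportional :: "complex^'n \<Rightarrow> complex^'n \<Rightarrow> bool" where
  "proportional v x \<longleftrightarrow> (\<forall>i j. v $ i * x $ j = v $ j * x $ i)"

definition pair_eval :: "(2 \<Rightarrow> poly4) \<Rightarrow> complex^4 \<Rightarrow> complex^2" where
  "pair_eval A x = (\<chi> i. peval (A i) x)"

text \<open>The rational map \<open>x \<mapsto> (A\<^sub>0:A\<^sub>1) \<times> (B\<^sub>0:B\<^sub>1) \<times> (C\<^sub>0:C\<^sub>1)\<close> is inverse to the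
  trilinear one: both composites are defined (generically) and are identities of rational maps.\<close>

definition is_inverse where
  "is_inverse w P A B C \<longleftrightarrow>
    (\<exists>s t u. pair_eval A (trilinear w P s t u) \<noteq> 0) \<and>
    (\<exists>s t u. pair_eval B (trilinear w P s t u) \<noteq> 0) \<and>
    (\<exists>s t u. pair_eval C (trilinear w P s t u) \<noteq> 0) \<and>
    (\<forall>s t u. proportional (pair_eval A (trilinear w P s t u)) s \<and>
             proportional (pair_eval B (trilinear w P s t u)) t \<and>
             proportional (pair_eval C (trilinear w P s t u)) u) \<and>
    (\<exists>x. trilinear w P (pair_eval A x) (pair_eval B x) (pair_eval C x) \<noteq> 0) \<and>
    (\<forall>x. proportional (trilinear w P (pair_eval A x) (pair_eval B x) (pair_eval C x)) x)"

text \<open>A pair of forms of degree \<open>d\<close> without common factor; \<open>coprime\<close> from the library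
  is not available for this polynomial ring.\<close>

definition reduced_pair :: "nat \<Rightarrow> (2 \<Rightarrow> poly4) \<Rightarrow> bool" where
  "reduced_pair d A \<longleftrightarrow>
    (\<forall>i. homogeneous d (A i)) \<and> (\<forall>h. h dvd A 0 \<longrightarrow> h dvd A 1 \<longrightarrow> h dvd 1)"

definition birational_of_type where
  "birational_of_type w P a b c \<longleftrightarrow>
    (\<exists>A B C. is_inverse w P A B C \<and> reduced_pair a A \<and> reduced_pair b B \<and> reduced_pair c C)"

end

theory Submission
  imports Defs "HOL-Computational_Algebra.Fundamental_Theorem_Algebra"
begin

text \<open>
  After division by \<open>\<pi>\<^sub>0\<close>, a pyramid has the normal form \<open>P i j 0 \<sim> f i j\<close>,
  \<open>P i j 1 \<sim> f i j + \<tau> i j A\<close>, where the \<open>f i j\<close> form a basis with \<open>\<pi>\<^sub>0 \<bullet> f i j = 1\<close> and the apex is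
  \<open>A = f 0 0 - f 0 1 - f 1 0 + f 1 1\<close>. The coordinates of \<open>A\<close> express the incidences: the planes
  \<open>\<Sigma>\<^sub>i\<close> and \<open>T\<^sub>j\<close> contain \<open>A\<close>, and \<open>\<pi>\<^sub>0\<close> lies in both pencils that they span. The equations of the two
  planes \<open>\<Sigma>\<^sub>i\<close>, and of the two planes \<open>T\<^sub>j\<close>, can then be scaled to have sum \<open>\<pi>\<^sub>0\<close>.

  Linear forms inverting the first parameter must vanish on \<open>\<Sigma>\<^sub>1\<close> and \<open>\<Sigma>\<^sub>0\<close>, so up to constants they are
  these equations, and comparing them makes the ratio of \<open>w 1 j k * (\<pi>\<^sub>0 \<bullet> P 1 j k)\<close> and
  \<open>w 0 j k * (\<pi>\<^sub>0 \<bullet> P 0 j k)\<close> independent of \<open>j, k\<close>; likewise for the second parameter. Conversely, for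
  weights of product form the plane equations recover the first two parameters, and the quadric
  \<open>y\<^sub>0\<^sub>0 y\<^sub>1\<^sub>1 - y\<^sub>0\<^sub>1 y\<^sub>1\<^sub>0\<close> in the coordinates with respect to \<open>f\<close> recovers the third.
\<close>

subsection \<open>Polynomials and their evaluation\<close>

lemma UNIV_2_01: "(UNIV :: 2 set) = {0, 1}"
  using UNIV_2 by auto

lemma sum_UNIV_2: "(\<Sum>i\<in>UNIV. f (i :: 2)) = f 0 + f 1"
  by (simp add: UNIV_2_01)

lemma all_2: "(\<forall>i::2. Q i) \<longleftrightarrow> Q 0 \<and> Q 1"
  by (metis UNIV_2_01 UNIV_I empty_iff insert_iff)

lemma UNIV_4_0123: "(UNIV :: 4 set) = {0, 1, 2, 3}"
proof -
  have "4 = (0::4)" by simp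
  then show ?thesis
    using UNIV_4 by blast
qed

lemma prod_UNIV_4: "(\<Prod>i\<in>UNIV. f (i :: 4)) = f 0 * f 1 * f 2 * f 3"
  unfolding UNIV_4_0123 by (simp add: mult_ac)

lemma all_4: "(\<forall>i::4. Q i) \<longleftrightarrow> Q 0 \<and> Q 1 \<and> Q 2 \<and> Q 3"
proof -
  have "(\<forall>i::4. Q i) \<longleftrightarrow> (\<forall>i\<in>UNIV. Q i)"
    by simp
  then show ?thesis
    unfolding UNIV_4_0123 by simp
qed

lemma poly_eq_const_off_0:
  fixes p :: "complex poly"
  assumes "\<And>z. z \<noteq> 0 \<Longrightarrow> poly p z = c"
  shows "poly p 0 = c"
proof -
  have "infinite (UNIV - {0 :: complex})"
    by (simp add: infinite_UNIV_char_0)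
  then have "infinite {z. poly (p - [:c:]) z = 0}"
    by (rule infinite_super[rotated]) (use assms in auto)
  then have "p - [:c:] = 0"
    using poly_roots_finite by blast
  then show ?thesis by simp
qed

section \<open>Evaluation as a ring homomorphism\<close>

definition monom_eval :: "(4 \<Rightarrow>\<^sub>0 nat) \<Rightarrow> complex^4 \<Rightarrow> complex" where
  "monom_eval m x = (\<Prod>n\<in>UNIV. (x $ n) ^ Poly_Mapping.lookup m n)"

lemma monom_eval_add: "monom_eval (m + n) x = monom_eval m x * monom_eval n x"
  by (simp add: monom_eval_def lookup_add power_add prod.distrib)

lemma monom_eval_0 [simp]: "monom_eval 0 x = 1"
  by (simp add: monom_eval_def)

text \<open>Cancellation can remove keys from a sum, so additivity becomes visible only over an
  index set chosen independently of the polynomial.\<close>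

lemma peval_superset:
  assumes "finite S" "Poly_Mapping.keys F \<subseteq> S"
  shows "peval F x = (\<Sum>m\<in>S. Poly_Mapping.lookup F m * monom_eval m x)"
  unfolding peval_def monom_eval_def
  by (rule sum.mono_neutral_left) (use assms in \<open>auto simp: in_keys_iff\<close>)

lemma peval_add [simp]: "peval (F + G) x = peval F x + peval G x"
proof -
  have "finite (Poly_Mapping.keys F \<union> Poly_Mapping.keys G)"
    by simp
  note superset = peval_superset[OF this]
  show ?thesis
    by (simp add: superset Poly_Mapping.keys_add lookup_add ring_distribs sum.distrib)
qed

lemma peval_single [simp]: "peval (Poly_Mapping.single m c) x = c * monom_eval m x"
  by (simp add: peval_def monom_eval_def)

lemma peval_0 [simp]: "peval 0 x = 0"
  by (simp add: peval_def)

lemma peval_1 [simp]: "peval 1 x = 1"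
  by (metis monom_eval_0 mult_1 peval_single single_one)

lemma peval_sum [simp]: "peval (\<Sum>a\<in>A. f a) x = (\<Sum>a\<in>A. peval (f a) x)"
  by (induction A rule: infinite_finite_induct) auto

lemma poly_mapping_eq_sum_single:
  "F = (\<Sum>m\<in>Poly_Mapping.keys F. Poly_Mapping.single m (Poly_Mapping.lookup F m))"
proof (rule poly_mapping_eqI)
  fix k
  show "Poly_Mapping.lookup F k = Poly_Mapping.lookup
      (\<Sum>m\<in>Poly_Mapping.keys F. Poly_Mapping.single m (Poly_Mapping.lookup F m)) k"
    by (simp add: lookup_sum lookup_single when_def not_in_keys_iff_lookup_eq_zero)
qed

lemma peval_mult [simp]: "peval (F * G) x = peval F x * peval G x"
proof -
  let ?s = "\<lambda>H m. Poly_Mapping.single m (Poly_Mapping.lookup H m)"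
  have "F * G = (\<Sum>m\<in>Poly_Mapping.keys F. \<Sum>n\<in>Poly_Mapping.keys G. ?s F m * ?s G n)"
    by (subst poly_mapping_eq_sum_single[of F], subst poly_mapping_eq_sum_single[of G])
      (rule sum_product)
  then have "peval (F * G) x =
      (\<Sum>m\<in>Poly_Mapping.keys F. \<Sum>n\<in>Poly_Mapping.keys G. peval (?s F m) x * peval (?s G n) x)"
    by (simp add: mult_single monom_eval_add mult_ac)
  also have "\<dots> = peval (\<Sum>m\<in>Poly_Mapping.keys F. ?s F m) x * peval (\<Sum>n\<in>Poly_Mapping.keys G. ?s G n) x"
    by (simp add: sum_product)
  finally show ?thesis
    by (simp flip: poly_mapping_eq_sum_single)
qed

lemma peval_power [simp]: "peval (F ^ n) x = peval F x ^ n"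
  by (induction n) auto

lemma peval_uminus [simp]: "peval (- F) x = - peval F x"
  using peval_add[of F "- F" x] by (simp add: add_eq_0_iff)

lemma peval_diff [simp]: "peval (F - G) x = peval F x - peval G x"
  using peval_add[of F "- G" x] by simp

abbreviation pconst :: "complex \<Rightarrow> poly4" where
  "pconst \<equiv> Poly_Mapping.single 0"

section \<open>Restriction to lines and the identity principle\<close>

lemma peval_on_line: "\<exists>p. \<forall>z. peval F (x + z *s y) = poly p z"
proof (intro exI allI)
  fix z
  show "peval F (x + z *s y) =
      poly (\<Sum>m\<in>Poly_Mapping.keys F. [:Poly_Mapping.lookup F m:] *
              (\<Prod>n\<in>UNIV. [:x $ n, y $ n:] ^ Poly_Mapping.lookup m n)) z"
    by (simp add: peval_def poly_sum poly_prod)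
qed

text \<open>By the fundamental theorem of algebra, a univariate polynomial without zeros is
  constant. This takes the place of the Nullstellensatz in the arguments about factors
  below.\<close>

lemma peval_on_line_const:
  assumes "\<And>z. peval F (x + z *s y) \<noteq> 0"
  shows "peval F (x + z *s y) = peval F x"
proof -
  obtain p where p: "\<And>z. peval F (x + z *s y) = poly p z"
    using peval_on_line by blast
  have "constant (poly p)"
    using assms fundamental_theorem_of_algebra[of p] by (auto simp: p)
  then have "poly p z = poly p 0"
    by (auto simp: constant_def)
  then show ?thesis
    using p[of z] p[of 0] by simp
qed

lemma peval_on_line_eq_const:
  assumes "\<And>z. z \<noteq> 0 \<Longrightarrow> peval F (x + z *s y) = c"
  shows "peval F x = c"
proof -
  obtain p where p: "\<And>z. peval F (x + z *s y) = poly p z"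
    using peval_on_line by blast
  have "poly p 0 = c"
    by (rule poly_eq_const_off_0) (use assms p in metis)
  then show ?thesis
    using p[of 0] by simp
qed

lemma peval_homogeneous_scale:
  assumes "homogeneous d F"
  shows "peval F (c *s x) = c ^ d * peval F x"
proof -
  have "(\<Prod>n\<in>UNIV. ((c *s x) $ n) ^ Poly_Mapping.lookup m n) =
      c ^ d * (\<Prod>n\<in>UNIV. (x $ n) ^ Poly_Mapping.lookup m n)" if "m \<in> Poly_Mapping.keys F" for m
    using assms that
    by (simp add: homogeneous_def power_mult_distrib prod.distrib flip: power_sum)
  then show ?thesis
    by (simp add: peval_def sum_distrib_left mult_ac)
qed

text \<open>Kronecker substitution: for \<open>N\<close> larger than all exponents, putting
  \<open>x\<^sub>n = z ^ (N ^ n)\<close> sends distinct monomials to distinct powers of \<open>z\<close>.\<close>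

lemma base_expansion_inj:
  fixes N :: nat
  assumes "a + N * b = a' + N * b'" "a < N" "a' < N"
  shows "a = a' \<and> b = b'"
proof -
  have "(a + N * b) mod N = a" "(a' + N * b') mod N = a'"
    using assms(2,3) by simp_all
  then have "a = a'"
    using assms(1) by simp
  then show ?thesis
    using assms by simp
qed

text \<open>The substitution yields a univariate polynomial \<open>p\<close> with the coefficients
  of \<open>F\<close>, and \<open>p\<close> vanishes everywhere. Polynomial identities can therefore
  be checked pointwise.\<close>

lemma peval_eq_0_imp_eq_0:
  assumes "\<And>x. peval F x = 0"
  shows "F = 0"
proof -
  let ?lk = Poly_Mapping.lookup
  \<comment> \<open>The sum of all exponents bounds each of them; \<open>Suc\<close> makes the bound
    strict, as digits in base \<open>N\<close> require.\<close>
  define N where "N = Suc (\<Sum>m\<in>Poly_Mapping.keys F. \<Sum>n\<in>UNIV. ?lk m n)"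
  define e where "e m = ?lk m 0 + N * (?lk m 1 + N * (?lk m 2 + N * ?lk m 3))"
    for m :: "4 \<Rightarrow>\<^sub>0 nat"
  have bound: "?lk m n < N" if "m \<in> Poly_Mapping.keys F" for m n
  proof -
    have "?lk m n \<le> (\<Sum>n\<in>UNIV. ?lk m n)"
      by (rule member_le_sum) auto
    also have "\<dots> \<le> (\<Sum>m\<in>Poly_Mapping.keys F. \<Sum>n\<in>UNIV. ?lk m n)"
      by (rule member_le_sum[OF that]) auto
    finally show ?thesis
      by (simp add: N_def)
  qed
  have inj: "inj_on e (Poly_Mapping.keys F)"
  proof (rule inj_onI)
    fix m m' assume m: "m \<in> Poly_Mapping.keys F" "m' \<in> Poly_Mapping.keys F" "e m = e m'"
    have "?lk m 0 = ?lk m' 0 \<and> ?lk m 1 = ?lk m' 1 \<and> ?lk m 2 = ?lk m' 2 \<and> ?lk m 3 = ?lk m' 3"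
      using m(3) bound[OF m(1)] bound[OF m(2)] unfolding e_def
      by (metis base_expansion_inj)
    then have "\<forall>n. ?lk m n = ?lk m' n"
      by (simp only: all_4)
    then show "m = m'"
      by (intro poly_mapping_eqI) simp
  qed
  define p where "p = (\<Sum>m\<in>Poly_Mapping.keys F. monom (?lk F m) (e m))"
  have "poly p z = 0" for z
  proof -
    define x :: "complex^4" where
      "x = (\<chi> n. if n = 0 then z else if n = 1 then z ^ N else if n = 2 then z ^ (N * N) else z ^ (N * N * N))"
    have "monom_eval m x = z ^ e m" for m
    proof -
      have "e m = ?lk m 0 + N * ?lk m 1 + N * N * ?lk m 2 + N * N * N * ?lk m 3"
        by (simp add: e_def algebra_simps)
      moreover have "monom_eval m x =
          z ^ ?lk m 0 * (z ^ N) ^ ?lk m 1 * (z ^ (N * N)) ^ ?lk m 2 * (z ^ (N * N * N)) ^ ?lk m 3"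
        unfolding monom_eval_def prod_UNIV_4 by (simp add: x_def)
      ultimately show ?thesis
        by (simp only: power_add power_mult)
    qed
    then have "peval F x = poly p z"
      by (simp add: peval_superset[OF finite_keys order_refl] p_def poly_sum poly_monom)
    then show ?thesis
      using assms by simp
  qed
  then have "p = 0"
    using poly_all_0_iff_0 by blast
  have "?lk F m = 0" if "m \<in> Poly_Mapping.keys F" for m
  proof -
    have "coeff p (e m) = (\<Sum>m'\<in>Poly_Mapping.keys F. if m' = m then ?lk F m' else 0)"
      unfolding p_def coeff_sum
      by (rule sum.cong) (use inj that in \<open>auto simp: inj_on_def\<close>)
    then show ?thesis
      using that \<open>p = 0\<close> by simp
  qed
  then have "?lk F m = 0" for m
    by (meson in_keys_iff)
  then show ?thesis
    by (intro poly_mapping_eqI) simp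
qed

lemma peval_inject: "(\<And>x. peval F x = peval G x) \<Longrightarrow> F = G"
  using peval_eq_0_imp_eq_0[of "F - G"] by simp

lemma peval_unit_nonzero:
  assumes "h dvd 1"
  shows "peval h x \<noteq> 0"
proof
  assume "peval h x = 0"
  moreover obtain k where "1 = h * k"
    using assms by blast
  ultimately have "peval 1 x = 0"
    by (metis mult_zero_left peval_mult)
  then show False by simp
qed

section \<open>Homogeneous polynomials and linear forms\<close>

lemma homogeneous_add: "homogeneous d F \<Longrightarrow> homogeneous d G \<Longrightarrow> homogeneous d (F + G)"
  unfolding homogeneous_def using Poly_Mapping.keys_add[of F G] by blast

lemma homogeneous_0 [simp]: "homogeneous d 0"
  by (simp add: homogeneous_def)

lemma homogeneous_sum: "(\<And>a. a \<in> S \<Longrightarrow> homogeneous d (f a)) \<Longrightarrow> homogeneous d (\<Sum>a\<in>S. f a)"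
  by (induction S rule: infinite_finite_induct) (auto intro: homogeneous_add)

lemma homogeneous_mult:
  assumes "homogeneous d F" "homogeneous e G"
  shows "homogeneous (d + e) (F * G)"
  unfolding homogeneous_def
proof
  fix m assume "m \<in> Poly_Mapping.keys (F * G)"
  then obtain a b where "m = a + b" "a \<in> Poly_Mapping.keys F" "b \<in> Poly_Mapping.keys G"
    using keys_mult by blast
  then show "(\<Sum>n\<in>UNIV. Poly_Mapping.lookup m n) = d + e"
    using assms by (simp add: homogeneous_def lookup_add sum.distrib)
qed

lemma homogeneous_pconst: "homogeneous 0 (pconst c)"
  by (simp add: homogeneous_def)

lemma homogeneous_scale: "homogeneous d F \<Longrightarrow> homogeneous d (pconst c * F)"
  using homogeneous_mult[OF homogeneous_pconst] by fastforce

definition linear_form :: "complex^4 \<Rightarrow> poly4" where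
  "linear_form c = (\<Sum>n\<in>UNIV. Poly_Mapping.single (Poly_Mapping.single n 1) (c $ n))"

lemma homogeneous_linear_form: "homogeneous 1 (linear_form c)"
  unfolding linear_form_def
  by (rule homogeneous_sum) (simp add: homogeneous_def lookup_single when_def)

lemma peval_linear_form: "peval (linear_form c) x = (\<Sum>n\<in>UNIV. c $ n * x $ n)"
proof -
  have "monom_eval (Poly_Mapping.single n 1) x = x $ n" for n
  proof -
    have "monom_eval (Poly_Mapping.single n 1) x = (\<Prod>k\<in>UNIV. if k = n then x $ k else 1)"
      unfolding monom_eval_def by (rule prod.cong) (auto simp: lookup_single when_def)
    then show ?thesis by simp
  qed
  then show ?thesis
    by (simp add: linear_form_def)
qed

text \<open>Natural exponents with sum 1 consist of one 1 and zeros, so every monomial is a single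
  coordinate. Inverses of degree 1 thereby become a matter of linear algebra.\<close>

lemma homogeneous_1_linear:
  assumes "homogeneous 1 F"
  shows "peval F (x + y) = peval F x + peval F y"
proof -
  have "monom_eval m x = (\<Sum>n\<in>UNIV. of_nat (Poly_Mapping.lookup m n) * x $ n)"
    if "m \<in> Poly_Mapping.keys F" for m x
  proof -
    have "(\<Sum>n\<in>UNIV. Poly_Mapping.lookup m n) = 1"
      using assms that by (simp add: homogeneous_def)
    then obtain k where k: "Poly_Mapping.lookup m k = 1"
        "\<And>n. n \<noteq> k \<Longrightarrow> Poly_Mapping.lookup m n = 0"
      by (metis UNIV_I finite sum_eq_1_iff)
    have "monom_eval m x = (\<Prod>n\<in>UNIV. if n = k then x $ n else 1)"
      unfolding monom_eval_def by (rule prod.cong) (auto simp: k)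
    moreover have "(\<Sum>n\<in>UNIV. of_nat (Poly_Mapping.lookup m n) * x $ n) =
        (\<Sum>n\<in>UNIV. if n = k then x $ n else 0)"
      by (rule sum.cong) (auto simp: k)
    ultimately show ?thesis by simp
  qed
  then show ?thesis
    by (simp add: peval_superset[OF finite_keys order_refl] ring_distribs sum.distrib)
qed

section \<open>Zero loci inside a plane, and common factors\<close>

text \<open>On the affine chart where the linear form is 1, \<open>F\<close> has no zeros, so it is
  constant on every line in the chart and hence on the chart. Homogeneity then determines
  \<open>F\<close> off the plane.\<close>

lemma homogeneous_zero_locus_within_plane:
  assumes "homogeneous d F" "c \<noteq> 0"
    and within: "\<And>x. peval F x = 0 \<Longrightarrow> x \<noteq> 0 \<Longrightarrow> peval (linear_form c) x = 0"
  shows "\<exists>a. F = pconst a * linear_form c ^ d"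
proof -
  let ?l = "\<lambda>x. peval (linear_form c) x"
  obtain n where n: "c $ n \<noteq> 0"
    using \<open>c \<noteq> 0\<close> by (metis vec_eq_iff zero_index)
  define v :: "complex^4" where "v = axis n (1 / c $ n)"
  have l_add: "?l (x + y) = ?l x + ?l y" for x y
    by (rule homogeneous_1_linear[OF homogeneous_linear_form])
  have l_scale: "?l (z *s x) = z * ?l x" for x z
    using peval_homogeneous_scale[OF homogeneous_linear_form] by simp
  have l_v: "?l v = 1"
    using n by (simp add: peval_linear_form v_def axis_def if_distrib cong: if_cong)
  have off: "peval F x = peval F v * ?l x ^ d" if "?l x \<noteq> 0" for x
  proof -
    \<comment> \<open>The direction from the base point \<open>v\<close> of the chart to the
      rescaling of \<open>x\<close> that lies in the chart.\<close>
    define y where "y = (1 / ?l x) *s x - v"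
    have y: "x = ?l x *s (v + 1 *s y)"
      using that by (simp add: y_def)
    have "?l y = 0"
    proof -
      have "?l (v + y) = 1"
        using that by (simp add: y_def l_scale)
      then show ?thesis by (simp add: l_add l_v)
    qed
    then have l1: "?l (v + z *s y) = 1" for z
      by (simp add: l_add l_scale l_v)
    have "peval F (v + z *s y) \<noteq> 0" for z
    proof
      assume *: "peval F (v + z *s y) = 0"
      have "v + z *s y \<noteq> 0"
      proof
        assume "v + z *s y = 0"
        then have "?l 0 = 1" using l1[of z] by simp
        then show False by (simp add: peval_linear_form)
      qed
      then show False using within[OF *] l1 by simp
    qed
    then have "peval F (v + 1 *s y) = peval F v"
      by (rule peval_on_line_const)
    moreover have "peval F x = ?l x ^ d * peval F (v + 1 *s y)"
      by (metis y peval_homogeneous_scale[OF assms(1)])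
    ultimately show ?thesis
      by simp
  qed
  \<comment> \<open>The extra factor makes the identity trivial on the plane, where
    \<open>off\<close> says nothing; it is then cancelled in the polynomial ring.\<close>
  have "(F - pconst (peval F v) * linear_form c ^ d) * linear_form c = 0"
    by (rule peval_eq_0_imp_eq_0) (use off in \<open>auto simp: algebra_simps\<close>)
  moreover have "linear_form c \<noteq> 0"
    using l_v by auto
  ultimately show ?thesis by auto
qed

text \<open>An irreducible polynomial that is a constant times a power of a linear form has exponent
  1.\<close>

lemma irreducible_zero_locus_within_plane:
  assumes "homogeneous d F" "irreducible F" "c \<noteq> 0"
    and "zero_locus F \<subseteq> zero_locus (linear_form c)"
  shows "d = 1 \<and> zero_locus F = zero_locus (linear_form c)"
proof -
  obtain a where a: "F = pconst a * linear_form c ^ d"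
    using homogeneous_zero_locus_within_plane[OF assms(1,3)] assms(4) by (auto simp: zero_locus_def)
  have "a \<noteq> 0"
    using a \<open>irreducible F\<close> by auto
  then have unit: "pconst a dvd 1"
    by (intro dvdI[of _ _ "pconst (1 / a)"]) (simp add: mult_single)
  have l: "\<not> linear_form c dvd 1"
    using peval_unit_nonzero[of "linear_form c" 0] by (auto simp: peval_linear_form)
  have "d \<noteq> 0"
  proof
    assume "d = 0"
    then have "F dvd 1"
      using a unit by simp
    then show False
      using irreducible_not_unit[OF \<open>irreducible F\<close>] by simp
  qed
  then obtain e where e: "d = Suc e"
    by (cases d) auto
  then have "F = linear_form c * (pconst a * linear_form c ^ e)"
    by (simp add: a mult_ac)
  then have "pconst a * linear_form c ^ e dvd 1"
    using l \<open>irreducible F\<close> by (auto dest: irreducibleD)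
  then have "linear_form c ^ e dvd 1"
    by (metis dvd_mult_right)
  then have "e = 0"
    using l by (metis dvd_power dvd_trans gr0I)
  then show ?thesis
    using a e \<open>a \<noteq> 0\<close> by (auto simp: zero_locus_def)
qed

text \<open>A common factor \<open>h\<close> has no zero at nontrivial combinations of
  \<open>p\<close> and \<open>q\<close>. Being constant on lines of such points, it is nonzero at
  the origin as well. Where \<open>F\<close> is nonzero, \<open>h\<close> then has no zero on the
  line to the origin and equals \<open>h(0)\<close>.\<close>

lemma homogeneous_coprime:
  assumes hom: "homogeneous d F" "homogeneous d G" and "F \<noteq> 0"
    and no_zero: "\<And>a b. peval F (a *s p + b *s q) = 0 \<Longrightarrow> peval G (a *s p + b *s q) = 0 \<Longrightarrow> a = 0 \<and> b = 0"
    and "h dvd F" "h dvd G"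
  shows "h dvd 1"
proof -
  obtain k where k: "F = h * k"
    using \<open>h dvd F\<close> by blast
  obtain k' where k': "G = h * k'"
    using \<open>h dvd G\<close> by blast
  have h_nz: "peval h (a *s p + b *s q) \<noteq> 0" if "a \<noteq> 0 \<or> b \<noteq> 0" for a b
    using no_zero[of a b] that by (auto simp: k k')
  have h_p: "peval h (p + b *s q) = peval h p" for b
    by (rule peval_on_line_const) (use h_nz[of 1] in simp)
  have h_q: "peval h (q + a *s p) = peval h q" for a
    by (rule peval_on_line_const) (use h_nz[of _ 1] in \<open>simp add: add.commute\<close>)
  have h_b: "peval h (0 + b *s q) = peval h p" if "b \<noteq> 0" for b
  proof -
    have "peval h (b *s q + 1 *s p) = peval h (b *s q)"
      by (rule peval_on_line_const) (use h_nz[of _ b] that in \<open>simp add: add.commute\<close>)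
    then show ?thesis
      using h_p[of b] by (simp add: add.commute)
  qed
  \<comment> \<open>The line through the origin and \<open>q\<close> is controlled only off the
    origin; a polynomial constant off one point keeps that value there.\<close>
  have "peval h 0 = peval h p"
    by (rule peval_on_line_eq_const) (rule h_b)
  then have h_0: "peval h 0 \<noteq> 0"
    using h_nz[of 1 0] by simp
  have "peval h x = peval h 0" if "peval F x \<noteq> 0" for x
  proof -
    have "peval h (0 + z *s x) \<noteq> 0" for z
    proof (cases "z = 0")
      case False
      then have "peval F (z *s x) \<noteq> 0"
        using that by (simp add: peval_homogeneous_scale[OF hom(1)])
      then show ?thesis by (simp add: k)
    qed (use h_0 in simp)
    from peval_on_line_const[of h, OF this, of 1] show ?thesis by simp
  qed
  then have "(h - pconst (peval h 0)) * F = 0"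
    by (intro peval_eq_0_imp_eq_0) auto
  then have "h = pconst (peval h 0)"
    using \<open>F \<noteq> 0\<close> by simp
  moreover have "pconst (peval h 0) * pconst (1 / peval h 0) = 1"
    using h_0 by (simp add: mult_single)
  ultimately show ?thesis
    by (metis dvdI)
qed

subsection \<open>Pyramids in normal form\<close>

lemma homogeneous_diff: "homogeneous d F \<Longrightarrow> homogeneous d G \<Longrightarrow> homogeneous d (F - G)"
  using homogeneous_add[of d F "pconst (- 1) * G"] homogeneous_scale[of d G "- 1"]
    peval_inject[of "F + pconst (- 1) * G" "F - G"] by simp

lemma cvec_nth [simp]: "cvec a $ n = complex_of_real (a $ n)"
  by (simp add: cvec_def)

lemma cvec_add: "cvec (a + b) = cvec a + cvec b"
  by (simp add: vec_eq_iff)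

lemma cvec_diff: "cvec (a - b) = cvec a - cvec b"
  by (simp add: vec_eq_iff)

lemma cvec_scaleR: "cvec (r *\<^sub>R a) = complex_of_real r *s cvec a"
  by (simp add: vec_eq_iff)

lemma cvec_sum: "cvec (\<Sum>i\<in>I. f i) = (\<Sum>i\<in>I. cvec (f i))"
  by (simp add: vec_eq_iff)

lemma cvec_eq_0_iff [simp]: "cvec a = 0 \<longleftrightarrow> a = 0"
  by (simp add: vec_eq_iff)

lemma complex_vec_cases:
  obtains a b where "x = cvec a + \<i> *s cvec b"
proof
  show "x = cvec (\<chi> n. Re (x $ n)) + \<i> *s cvec (\<chi> n. Im (x $ n))"
    by (simp add: vec_eq_iff complex_eq)
qed

lemma peval_linear_form_cvec: "peval (linear_form (cvec a)) (cvec b) = complex_of_real (a \<bullet> b)"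
  by (simp add: peval_linear_form inner_vec_def)

lemma linear_form_linear:
  "peval (linear_form c) (x + y) = peval (linear_form c) x + peval (linear_form c) y"
  "peval (linear_form c) (a *s x) = a * peval (linear_form c) x"
  "peval (linear_form c) (\<Sum>i\<in>I. z i) = (\<Sum>i\<in>I. peval (linear_form c) (z i))"
  by (simp_all add: peval_linear_form ring_distribs sum.distrib sum_distrib_left mult_ac
      sum.swap[of _ I])

lemma proportional_2_iff:
  fixes v x :: "complex^2"
  shows "proportional v x \<longleftrightarrow> v $ 0 * x $ 1 = v $ 1 * x $ 0"
  unfolding proportional_def all_2 by argo

lemma trilinear_axis:
  "trilinear w P (axis i 1) (axis j 1) (axis k 1) = complex_of_real (w i j k) *s cvec (P i j k)"
proof -
  have "\<forall>i j k. trilinear w P (axis i 1) (axis j 1) (axis k 1) = complex_of_real (w i j k) *s cvec (P i j k)"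
    by (simp add: all_2 trilinear_def sum_UNIV_2 axis_def)
  then show ?thesis by blast
qed

lemma trilinear_one_axis_axis:
  "trilinear w P 1 (axis j 1) (axis k 1) =
    complex_of_real (w 0 j k) *s cvec (P 0 j k) + complex_of_real (w 1 j k) *s cvec (P 1 j k)"
proof -
  have "\<forall>j k. trilinear w P 1 (axis j 1) (axis k 1) =
      complex_of_real (w 0 j k) *s cvec (P 0 j k) + complex_of_real (w 1 j k) *s cvec (P 1 j k)"
    by (simp add: all_2 trilinear_def sum_UNIV_2 axis_def)
  then show ?thesis by blast
qed

text \<open>Exchanging the first two parameters transfers results about the first one to the
  second.\<close>

lemma trilinear_swap: "trilinear (\<lambda>i j. w j i) (\<lambda>i j. P j i) t s u = trilinear w P s t u"
  unfolding trilinear_def by (subst sum.swap) (simp add: mult_ac)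

text \<open>Here \<open>h i j k\<close> stands for \<open>\<pi>\<^sub>0 \<bullet> P i j k\<close>,
  the reciprocal of \<Delta>, and \<open>g\<close> is the basis dual to \<open>f\<close>. The
  geometry of the boundary surfaces survives only in the signs of the apex and in the nonvanishing
  conditions.\<close>

locale pyramid_normal_form =
  fixes w h :: "2 \<Rightarrow> 2 \<Rightarrow> 2 \<Rightarrow> real" and P :: "2 \<Rightarrow> 2 \<Rightarrow> 2 \<Rightarrow> real^4"
    and f g :: "2 \<Rightarrow> 2 \<Rightarrow> real^4" and \<tau> :: "2 \<Rightarrow> 2 \<Rightarrow> real"
  assumes dual: "g i j \<bullet> f k l = (if i = k \<and> j = l then 1 else 0)"
    and expand: "x = (\<Sum>i\<in>UNIV. \<Sum>j\<in>UNIV. (g i j \<bullet> x) *\<^sub>R f i j)"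
    and P_0: "P i j 0 = h i j 0 *\<^sub>R f i j"
    and P_1: "P i j 1 = h i j 1 *\<^sub>R (f i j + \<tau> i j *\<^sub>R (f 0 0 - f 0 1 - f 1 0 + f 1 1))"
    and w_nz: "w i j k \<noteq> 0" and h_nz: "h i j k \<noteq> 0" and \<tau>_nz: "\<tau> i j \<noteq> 0"
begin

text \<open>Transposing the indices of \<open>f\<close> leaves the apex unchanged.\<close>

lemma swap:
  "pyramid_normal_form (\<lambda>i j. w j i) (\<lambda>i j. h j i) (\<lambda>i j. P j i) (\<lambda>i j. f j i) (\<lambda>i j. g j i) (\<lambda>i j. \<tau> j i)"
proof
  show "x = (\<Sum>i\<in>UNIV. \<Sum>j\<in>UNIV. (g j i \<bullet> x) *\<^sub>R f j i)" for x
    by (subst sum.swap) (rule expand)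
  show "P j i 1 = h j i 1 *\<^sub>R (f j i + \<tau> j i *\<^sub>R (f 0 0 - f 1 0 - f 0 1 + f 1 1))" for i j
    by (simp add: P_1 algebra_simps)
qed (simp_all add: dual P_0 w_nz h_nz \<tau>_nz conj_commute)

section \<open>Necessity of the product form\<close>

text \<open>The two linear forms are determined on all control points up to constants
  \<open>c0\<close> and \<open>c1\<close>; comparing them along the edges in the first parameter
  fixes the ratio of the weights.\<close>

lemma weight_ratio:
  fixes L :: "2 \<Rightarrow> complex^4 \<Rightarrow> complex"
  assumes add: "\<And>i x y. L i (x + y) = L i x + L i y"
    and scale: "\<And>i c x. L i (c *s x) = c * L i x"
    and proportional: "\<And>s t u. proportional (\<chi> i. L i (trilinear w P s t u)) s"
    and nz: "(\<chi> i. L i (trilinear w P s0 t0 u0)) \<noteq> 0"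
  shows "\<exists>\<rho>. \<forall>j k. w 1 j k * h 1 j k = \<rho> * (w 0 j k * h 0 j k)"
proof -
  have diff: "L i (x - y) = L i x - L i y" for i x y
    using add[of i "x - y" y] by simp
  have cross: "L 0 (trilinear w P s t u) * s $ 1 = L 1 (trilinear w P s t u) * s $ 0" for s t u
    using proportional[of s t u] by (simp add: proportional_2_iff)
  \<comment> \<open>At a corner with s = (1:0), proportionality to s makes the second form vanish;
    below, s = (0:1) does the same for the first form.\<close>
  have L1_P: "L 1 (cvec (P 0 j k)) = 0" for j k
    using cross[of "axis 0 1" "axis j 1" "axis k 1"] w_nz
    by (simp add: trilinear_axis scale) (simp add: axis_def)
  have L0_P: "L 0 (cvec (P 1 j k)) = 0" for j k
    using cross[of "axis 1 1" "axis j 1" "axis k 1"] w_nz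
    by (simp add: trilinear_axis scale) (simp add: axis_def)
  let ?A = "cvec (f 0 0) - cvec (f 0 1) - cvec (f 1 0) + cvec (f 1 1)"
  have L_P_0: "L m (cvec (P i j 0)) = h i j 0 * L m (cvec (f i j))" for m i j
    by (simp add: P_0 cvec_scaleR scale)
  have L_P_1: "L m (cvec (P i j 1)) = h i j 1 * (L m (cvec (f i j)) + \<tau> i j * L m ?A)" for m i j
    by (simp add: P_1 cvec_scaleR cvec_add cvec_diff scale add diff algebra_simps)
  have L1_f: "L 1 (cvec (f 0 j)) = 0" for j
    using L1_P[of j 0] h_nz by (simp add: L_P_0)
  have L0_f: "L 0 (cvec (f 1 j)) = 0" for j
    using L0_P[of j 0] h_nz by (simp add: L_P_0)
  \<comment> \<open>As \<tau> is nonzero, the apex is a combination of \<open>P 0 0 0\<close> and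
    \<open>P 0 0 1\<close>, both killed by \<open>L 1\<close>.\<close>
  have L1_A: "L 1 ?A = 0"
    using L1_P[of 0 1] h_nz \<tau>_nz by (simp add: L_P_1 L1_f)
  have L0_A: "L 0 ?A = 0"
    using L0_P[of 0 1] h_nz \<tau>_nz by (simp add: L_P_1 L0_f)
  define c0 where "c0 = L 0 (cvec (f 0 0))"
  define c1 where "c1 = L 1 (cvec (f 1 0))"
  \<comment> \<open>\<open>L 0\<close> kills the apex, \<open>f 1 0\<close> and
    \<open>f 1 1\<close>, so the signs of the apex force equal values on \<open>f 0 0\<close> and
    \<open>f 0 1\<close>.\<close>
  have c0: "L 0 (cvec (f 0 j)) = c0" for j
  proof -
    have "\<forall>j. L 0 (cvec (f 0 j)) = c0"
      using L0_A by (simp add: all_2 c0_def add diff L0_f)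
    then show ?thesis by blast
  qed
  have c1: "L 1 (cvec (f 1 j)) = c1" for j
  proof -
    have "\<forall>j. L 1 (cvec (f 1 j)) = c1"
      using L1_A by (simp add: all_2 c1_def add diff L1_f)
    then show ?thesis by blast
  qed
  have L0_h: "L 0 (cvec (P 0 j k)) = h 0 j k * c0" for j k
  proof -
    have "\<forall>k. L 0 (cvec (P 0 j k)) = h 0 j k * c0"
      by (simp add: all_2 L_P_0 L_P_1 L0_A c0)
    then show ?thesis by blast
  qed
  have L1_h: "L 1 (cvec (P 1 j k)) = h 1 j k * c1" for j k
  proof -
    have "\<forall>k. L 1 (cvec (P 1 j k)) = h 1 j k * c1"
      by (simp add: all_2 L_P_0 L_P_1 L1_A c1)
    then show ?thesis by blast
  qed
  \<comment> \<open>The parameter \<open>1\<close> is (1:1), where \<open>cross\<close> equates the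
    values of the two forms.\<close>
  have rel: "w 0 j k * h 0 j k * c0 = w 1 j k * h 1 j k * c1" for j k
    using cross[of 1 "axis j 1" "axis k 1"]
    by (simp add: trilinear_one_axis_axis scale add L0_P L1_P L0_h L1_h mult.assoc)
  \<comment> \<open>If both constants vanished, both forms would vanish on the whole image, against
    \<open>nz\<close>; once one is nonzero, \<open>rel\<close> makes the other nonzero.\<close>
  have "c0 \<noteq> 0 \<or> c1 \<noteq> 0"
  proof (rule ccontr)
    assume "\<not> (c0 \<noteq> 0 \<or> c1 \<noteq> 0)"
    then have "\<forall>m i. L m (cvec (P i j k)) = 0" for j k
      by (simp add: all_2 L0_h L1_h L0_P L1_P)
    then have "(\<chi> i. L i (trilinear w P s0 t0 u0)) = 0"
      by (simp add: trilinear_def sum_UNIV_2 add scale vec_eq_iff)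
    with nz show False by simp
  qed
  then have c_nz: "c0 \<noteq> 0" "c1 \<noteq> 0"
    using rel[of 0 0] w_nz h_nz by auto
  have "w 1 j k * h 1 j k = (w 1 0 0 * h 1 0 0) / (w 0 0 0 * h 0 0 0) * (w 0 j k * h 0 j k)" for j k
  proof -
    \<comment> \<open>Cross-multiplying two instances of \<open>rel\<close> allows the complex
      constants to be cancelled; what remains is an identity between real numbers.\<close>
    have "(w 1 j k * h 1 j k * c1) * (w 0 0 0 * h 0 0 0 * c0) = (w 1 0 0 * h 1 0 0 * c1) * (w 0 j k * h 0 j k * c0)"
      unfolding rel[symmetric] by (rule mult.commute)
    then have "complex_of_real ((w 1 j k * h 1 j k) * (w 0 0 0 * h 0 0 0)) =
        complex_of_real ((w 1 0 0 * h 1 0 0) * (w 0 j k * h 0 j k))"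
      using c_nz by (simp add: mult_ac)
    then show ?thesis
      unfolding of_real_eq_iff using w_nz h_nz by (simp add: field_simps)
  qed
  then show ?thesis by blast
qed

lemma linear_inverse_weight_ratio:
  assumes "\<And>i. homogeneous 1 (A i)"
    and "pair_eval A (trilinear w P s0 t0 u0) \<noteq> 0"
    and "\<And>s t u. proportional (pair_eval A (trilinear w P s t u)) s"
  shows "\<exists>\<rho>. \<forall>j k. w 1 j k * h 1 j k = \<rho> * (w 0 j k * h 0 j k)"
proof (rule weight_ratio[of "\<lambda>i. peval (A i)"])
  show "peval (A i) (x + y) = peval (A i) x + peval (A i) y" for i x y
    by (rule homogeneous_1_linear[OF assms(1)])
  show "peval (A i) (c *s x) = c * peval (A i) x" for i c x
    using peval_homogeneous_scale[OF assms(1)] by simp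
qed (use assms(2,3) in \<open>simp_all add: pair_eval_def\<close>)

lemma birational_imp_weights:
  assumes "birational_of_type w P 1 1 c"
  shows "\<exists>\<alpha> \<beta> \<gamma> :: real^2. \<alpha> \<noteq> 0 \<and> \<beta> \<noteq> 0 \<and> \<gamma> \<noteq> 0 \<and>
      (\<forall>i j k. w i j k * h i j k = \<alpha> $ i * \<beta> $ j * \<gamma> $ k)"
proof -
  obtain A B C where inv: "is_inverse w P A B C" and red: "reduced_pair 1 A" "reduced_pair 1 B"
    using assms by (auto simp: birational_of_type_def)
  interpret swapped: pyramid_normal_form "\<lambda>i j. w j i" "\<lambda>i j. h j i" "\<lambda>i j. P j i"
      "\<lambda>i j. f j i" "\<lambda>i j. g j i" "\<lambda>i j. \<tau> j i"
    by (rule swap)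
  obtain s t u s' t' u' where A_nz: "pair_eval A (trilinear w P s t u) \<noteq> 0"
    and B_nz: "pair_eval B (trilinear w P s' t' u') \<noteq> 0"
    using inv unfolding is_inverse_def by blast
  have prop_A: "proportional (pair_eval A (trilinear w P s t u)) s"
    and prop_B: "proportional (pair_eval B (trilinear w P s t u)) t" for s t u
    using inv unfolding is_inverse_def by blast+
  have hom: "homogeneous 1 (A i)" "homogeneous 1 (B i)" for i
    using red unfolding reduced_pair_def by blast+
  obtain \<rho> where \<rho>: "\<And>j k. w 1 j k * h 1 j k = \<rho> * (w 0 j k * h 0 j k)"
    using linear_inverse_weight_ratio[OF hom(1) A_nz prop_A] by blast
  obtain \<sigma> where \<sigma>: "\<And>i k. w i 1 k * h i 1 k = \<sigma> * (w i 0 k * h i 0 k)"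
    using swapped.linear_inverse_weight_ratio[OF hom(2), unfolded trilinear_swap[of w P], OF B_nz prop_B] by blast
  \<comment> \<open>Normalising the first entries of \<alpha> and \<beta> to 1 leaves the values at
    i = j = 0 to \<gamma>. One nonzero entry suffices for a point of the projective line.\<close>
  define \<alpha> :: "real^2" where "\<alpha> = (\<chi> i. if i = 0 then 1 else \<rho>)"
  define \<beta> :: "real^2" where "\<beta> = (\<chi> i. if i = 0 then 1 else \<sigma>)"
  define \<gamma> :: "real^2" where "\<gamma> = (\<chi> k. w 0 0 k * h 0 0 k)"
  have "\<alpha> $ 0 \<noteq> 0" "\<beta> $ 0 \<noteq> 0" "\<gamma> $ 0 \<noteq> 0"
    by (simp_all add: \<alpha>_def \<beta>_def \<gamma>_def w_nz h_nz)
  then have "\<alpha> \<noteq> 0" "\<beta> \<noteq> 0" "\<gamma> \<noteq> 0"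
    by auto
  moreover have "\<forall>i j. w i j k * h i j k = \<alpha> $ i * \<beta> $ j * \<gamma> $ k" for k
    unfolding all_2 by (simp add: \<alpha>_def \<beta>_def \<gamma>_def \<rho> \<sigma>)
  ultimately show ?thesis by blast
qed

section \<open>Sufficiency of the product form\<close>

abbreviation F :: "2 \<Rightarrow> 2 \<Rightarrow> complex^4" where "F i j \<equiv> cvec (f i j)"

definition Y :: "2 \<Rightarrow> 2 \<Rightarrow> poly4" where "Y i j = linear_form (cvec (g i j))"

lemma peval_Y_combination: "peval (Y i j) (\<Sum>k\<in>UNIV. \<Sum>l\<in>UNIV. c k l *s F k l) = c i j"
proof -
  have "\<forall>i j. peval (Y i j) (\<Sum>k\<in>UNIV. \<Sum>l\<in>UNIV. c k l *s F k l) = c i j"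
    by (simp add: all_2 sum_UNIV_2 Y_def linear_form_linear peval_linear_form_cvec dual)
  then show ?thesis by blast
qed

text \<open>A real basis is also a complex basis: real and imaginary parts are expanded
  separately.\<close>

lemma complex_expand: "x = (\<Sum>i\<in>UNIV. \<Sum>j\<in>UNIV. peval (Y i j) x *s F i j)"
proof -
  obtain a b where x: "x = cvec a + \<i> *s cvec b"
    by (rule complex_vec_cases)
  have y: "peval (Y i j) x = complex_of_real (g i j \<bullet> a) + \<i> * complex_of_real (g i j \<bullet> b)" for i j
    by (simp add: x Y_def linear_form_linear peval_linear_form_cvec)
  have "cvec c = (\<Sum>i\<in>UNIV. \<Sum>j\<in>UNIV. complex_of_real (g i j \<bullet> c) *s F i j)" for c
    using arg_cong[OF expand[of c], of cvec] by (simp add: cvec_sum cvec_scaleR)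
  from this[of a] this[of b]
  have "x = (\<Sum>i\<in>UNIV. \<Sum>j\<in>UNIV. complex_of_real (g i j \<bullet> a) *s F i j) +
      \<i> *s (\<Sum>i\<in>UNIV. \<Sum>j\<in>UNIV. complex_of_real (g i j \<bullet> b) *s F i j)"
    unfolding x by (rule arg_cong2[where f = "\<lambda>a b. a + \<i> *s b"])
  then show ?thesis
    unfolding y by (simp add: sum_UNIV_2 vec_eq_iff algebra_simps)
qed

text \<open>For weights of product form, points with u = (1:0) have coordinate matrices of rank at
  most one, so this determinant is an equation of the boundary quadric
  \<open>Y_surf w P 0\<close>.\<close>

definition D :: poly4 where "D = Y 0 0 * Y 1 1 - Y 0 1 * Y 1 0"

text \<open>This form kills the apex and the \<open>f k j\<close> with k different from i: it is an
  equation of the plane \<Sigma> with index other than i. Likewise \<open>M j\<close> for the planes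
  T.\<close>

definition \<Lambda> :: "2 \<Rightarrow> poly4" where "\<Lambda> i = Y i 0 + Y i 1"

definition M :: "2 \<Rightarrow> poly4" where "M j = Y 0 j + Y 1 j"

text \<open>For weights of product form, \<Lambda> and \<open>M\<close> recover the rescaled first
  two parameters up to factors, so \<open>G\<close> recovers the bilinear form with coefficients
  \<tau>. The difference \<open>G - D\<close> vanishes on the other boundary quadric.\<close>

definition G :: poly4 where "G = (\<Sum>i\<in>UNIV. \<Sum>j\<in>UNIV. pconst (\<tau> i j) * \<Lambda> i * M j)"

lemma homogeneous_forms:
  "homogeneous 1 (\<Lambda> i)" "homogeneous 1 (M j)" "homogeneous 2 D" "homogeneous 2 G"
proof -
  have Y: "homogeneous 1 (Y i j)" for i j
    unfolding Y_def by (rule homogeneous_linear_form)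
  show L: "homogeneous 1 (\<Lambda> i)" for i
    unfolding \<Lambda>_def by (intro homogeneous_add Y)
  show M: "homogeneous 1 (M j)" for j
    unfolding M_def by (intro homogeneous_add Y)
  have "homogeneous (1 + 1) D"
    unfolding D_def by (intro homogeneous_diff homogeneous_mult Y)
  then show "homogeneous 2 D" by (simp add: numeral_2_eq_2)
  have "homogeneous (1 + 1) G"
    unfolding G_def by (intro homogeneous_sum homogeneous_mult homogeneous_scale L M)
  then show "homogeneous 2 G" by (simp add: numeral_2_eq_2)
qed

text \<open>With \<alpha>, \<beta>, \<gamma> absorbed into the parameters, the coordinate matrix is
  a matrix of rank at most one plus \<open>Z\<close> times the sign matrix of the apex. Row and
  column sums eliminate the second part.\<close>

lemma weights_imp_trilinear:
  fixes \<alpha> \<beta> \<gamma> :: "real^2" and s t u :: "complex^2" and S T U :: "2 \<Rightarrow> complex" and Z :: complex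
  assumes "\<And>i j k. w i j k * h i j k = \<alpha> $ i * \<beta> $ j * \<gamma> $ k"
  defines "S \<equiv> \<lambda>i. \<alpha> $ i * s $ i" and "T \<equiv> \<lambda>j. \<beta> $ j * t $ j" and "U \<equiv> \<lambda>k. \<gamma> $ k * u $ k"
  defines "Z \<equiv> U 1 * (\<Sum>i\<in>UNIV. \<Sum>j\<in>UNIV. \<tau> i j * S i * T j)"
  shows "trilinear w P s t u =
    (\<Sum>i\<in>UNIV. \<Sum>j\<in>UNIV. (S i * T j * (U 0 + U 1) + (if i = j then Z else - Z)) *s F i j)"
proof -
  have wh: "complex_of_real (w i j k) * complex_of_real (h i j k) = \<alpha> $ i * \<beta> $ j * \<gamma> $ k" for i j k
    using assms(1)[of i j k] by (metis of_real_mult)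
  let ?A = "F 0 0 - F 0 1 - F 1 0 + F 1 1"
  have wP_0: "complex_of_real (w i j 0) *s cvec (P i j 0) = (\<alpha> $ i * \<beta> $ j * \<gamma> $ 0) *s F i j" for i j
    by (simp add: P_0 cvec_scaleR vector_smult_assoc wh)
  have wP_1: "complex_of_real (w i j 1) *s cvec (P i j 1) =
      (\<alpha> $ i * \<beta> $ j * \<gamma> $ 1) *s (F i j + complex_of_real (\<tau> i j) *s ?A)" for i j
    by (simp only: P_1 cvec_scaleR cvec_add cvec_diff vector_smult_assoc wh)
  have "trilinear w P s t u =
      (\<Sum>i\<in>UNIV. \<Sum>j\<in>UNIV. (s $ i * t $ j * u $ 0) *s (complex_of_real (w i j 0) *s cvec (P i j 0)) +
        (s $ i * t $ j * u $ 1) *s (complex_of_real (w i j 1) *s cvec (P i j 1)))"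
    by (simp add: trilinear_def sum_UNIV_2 vector_smult_assoc mult_ac)
  also have "\<dots> = (\<Sum>i\<in>UNIV. \<Sum>j\<in>UNIV. (S i * T j * U 0) *s F i j +
        (S i * T j * U 1) *s (F i j + complex_of_real (\<tau> i j) *s ?A))"
    unfolding wP_0 wP_1 by (simp add: vector_smult_assoc S_def T_def U_def mult_ac)
  also have "\<dots> =
    (\<Sum>i\<in>UNIV. \<Sum>j\<in>UNIV. (S i * T j * (U 0 + U 1) + (if i = j then Z else - Z)) *s F i j)"
    unfolding Z_def vec_eq_iff by (simp add: sum_UNIV_2) (simp add: algebra_simps)
  finally show ?thesis .
qed

text \<open>On the image, \<open>D : G = U\<^sub>1 : (U\<^sub>0 + U\<^sub>1)\<close>, which recovers the third parameter. No pair of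
  forms below has a common zero on the line through \<open>f 0 0\<close> and \<open>f 1 1\<close>, hence none has a common factor.\<close>

lemma weights_imp_birational:
  fixes \<alpha> \<beta> \<gamma> :: "real^2"
  assumes wh: "\<And>i j k. w i j k * h i j k = \<alpha> $ i * \<beta> $ j * \<gamma> $ k"
  shows "birational_of_type w P 1 1 2"
proof -
  have nz: "\<alpha> $ i \<noteq> 0" "\<beta> $ j \<noteq> 0" "\<gamma> $ k \<noteq> 0" for i j k
    using wh[of i j k] w_nz[of i j k] h_nz[of i j k] by auto
  define A where "A i = pconst (1 / \<alpha> $ i) * \<Lambda> i" for i
  define B where "B j = pconst (1 / \<beta> $ j) * M j" for j
  define C where "C k = pconst (1 / \<gamma> $ k) * (if k = 0 then G - D else D)" for k :: 2
  let ?\<phi> = "trilinear w P"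
  have eval_G: "peval G x = (\<Sum>i\<in>UNIV. \<Sum>j\<in>UNIV. \<tau> i j * peval (\<Lambda> i) x * peval (M j) x)" for x
    by (simp add: G_def)
  have eval_A: "peval (A i) x = peval (\<Lambda> i) x / \<alpha> $ i" for i x
    by (simp add: A_def)
  have eval_B: "peval (B j) x = peval (M j) x / \<beta> $ j" for j x
    by (simp add: B_def)
  have eval_C: "peval (C 0) x = (peval G x - peval D x) / \<gamma> $ 0" "peval (C 1) x = peval D x / \<gamma> $ 1" for x
    by (simp_all add: C_def)
  have left: "proportional (pair_eval A (?\<phi> s t u)) s \<and> proportional (pair_eval B (?\<phi> s t u)) t \<and>
      proportional (pair_eval C (?\<phi> s t u)) u" for s t u
  proof -
    define S where "S i = \<alpha> $ i * s $ i" for i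
    define T where "T j = \<beta> $ j * t $ j" for j
    define U where "U k = \<gamma> $ k * u $ k" for k
    define q where "q = (\<Sum>i\<in>UNIV. \<Sum>j\<in>UNIV. \<tau> i j * S i * T j)"
    have Y: "peval (Y i j) (?\<phi> s t u) = S i * T j * (U 0 + U 1) + (if i = j then U 1 * q else - (U 1 * q))"
      for i j
      unfolding weights_imp_trilinear[OF wh] peval_Y_combination S_def T_def U_def q_def ..
    have L: "peval (\<Lambda> i) (?\<phi> s t u) = S i * ((T 0 + T 1) * (U 0 + U 1))" for i
    proof -
      have "\<forall>i. peval (\<Lambda> i) (?\<phi> s t u) = S i * ((T 0 + T 1) * (U 0 + U 1))"
        by (simp add: all_2 \<Lambda>_def Y algebra_simps)
      then show ?thesis by blast
    qed
    have M: "peval (M j) (?\<phi> s t u) = T j * ((S 0 + S 1) * (U 0 + U 1))" for j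
    proof -
      have "\<forall>j. peval (M j) (?\<phi> s t u) = T j * ((S 0 + S 1) * (U 0 + U 1))"
        by (simp add: all_2 M_def Y algebra_simps)
      then show ?thesis by blast
    qed
    \<comment> \<open>The factor common to both components of \<open>C\<close> on the image; it
      drops out of their ratio.\<close>
    define K where "K = (S 0 + S 1) * (T 0 + T 1) * (U 0 + U 1) * q"
    have D: "peval D (?\<phi> s t u) = U 1 * K"
      by (simp add: D_def Y K_def algebra_simps)
    have G: "peval G (?\<phi> s t u) = (U 0 + U 1) * K"
      unfolding eval_G L M K_def q_def by (simp add: sum_UNIV_2) algebra
    have GD: "peval G (?\<phi> s t u) - peval D (?\<phi> s t u) = U 0 * K"
      unfolding D G by (simp add: ring_distribs)
    have "peval (C 0) (?\<phi> s t u) = K * u $ 0"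
      using nz unfolding eval_C GD by (simp add: U_def)
    moreover have "peval (C 1) (?\<phi> s t u) = K * u $ 1"
      using nz unfolding eval_C D by (simp add: U_def)
    moreover have "peval (A i) (?\<phi> s t u) = ((T 0 + T 1) * (U 0 + U 1)) * s $ i" for i
      using nz unfolding eval_A L by (simp add: S_def)
    moreover have "peval (B j) (?\<phi> s t u) = ((S 0 + S 1) * (U 0 + U 1)) * t $ j" for j
      using nz unfolding eval_B M by (simp add: T_def)
    ultimately show ?thesis
      by (simp add: proportional_2_iff pair_eval_def mult_ac)
  qed
  have right: "?\<phi> (pair_eval A x) (pair_eval B x) (pair_eval C x) =
      (peval G x * (\<Sum>i\<in>UNIV. peval (\<Lambda> i) x)) *s x" for x
  proof -
    let ?y = "\<lambda>i j. peval (Y i j) x"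
    have S: "\<alpha> $ i * pair_eval A x $ i = ?y i 0 + ?y i 1" for i
      using nz by (simp add: pair_eval_def eval_A \<Lambda>_def)
    have T: "\<beta> $ j * pair_eval B x $ j = ?y 0 j + ?y 1 j" for j
      using nz by (simp add: pair_eval_def eval_B M_def)
    have U: "\<gamma> $ 0 * pair_eval C x $ 0 = peval G x - peval D x" "\<gamma> $ 1 * pair_eval C x $ 1 = peval D x"
      using nz by (simp_all add: pair_eval_def eval_C)
    have q: "(\<Sum>i\<in>UNIV. \<Sum>j\<in>UNIV. \<tau> i j * (?y i 0 + ?y i 1) * (?y 0 j + ?y 1 j)) = peval G x"
      by (simp add: eval_G \<Lambda>_def M_def)
    have "?\<phi> (pair_eval A x) (pair_eval B x) (pair_eval C x) = (\<Sum>i\<in>UNIV. \<Sum>j\<in>UNIV.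
        ((?y i 0 + ?y i 1) * (?y 0 j + ?y 1 j) * peval G x +
          (if i = j then peval D x * peval G x else - (peval D x * peval G x))) *s F i j)"
      unfolding weights_imp_trilinear[OF wh] S T U q by simp
    \<comment> \<open>For a 2 by 2 matrix, the sum of row i times the sum of column j equals the
      entry times the total, minus the determinant if i = j and plus it otherwise.\<close>
    also have "\<dots> = (\<Sum>i\<in>UNIV. \<Sum>j\<in>UNIV. (peval G x * (\<Sum>i\<in>UNIV. peval (\<Lambda> i) x) * ?y i j) *s F i j)"
      by (simp add: sum_UNIV_2 \<Lambda>_def D_def algebra_simps)
    also have "\<dots> = (peval G x * (\<Sum>i\<in>UNIV. peval (\<Lambda> i) x)) *s
        (\<Sum>i\<in>UNIV. \<Sum>j\<in>UNIV. ?y i j *s F i j)"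
      by (simp add: sum_UNIV_2 vector_smult_assoc vector_add_ldistrib)
    also have "(\<Sum>i\<in>UNIV. \<Sum>j\<in>UNIV. ?y i j *s F i j) = x"
      by (rule complex_expand[symmetric])
    finally show ?thesis .
  qed
  have Y_diag: "peval (Y i j) (a *s F 0 0 + b *s F 1 1) = (if i = j then if i = 0 then a else b else 0)"
    for i j a b
  proof -
    have "\<forall>i j. peval (Y i j) (a *s F 0 0 + b *s F 1 1) = (if i = j then if i = 0 then a else b else 0)"
      by (simp add: all_2 Y_def linear_form_linear peval_linear_form_cvec dual)
    then show ?thesis by blast
  qed
  have L_diag: "peval (\<Lambda> 0) (a *s F 0 0 + b *s F 1 1) = a" "peval (\<Lambda> 1) (a *s F 0 0 + b *s F 1 1) = b" for a b
    by (simp_all add: \<Lambda>_def Y_diag)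
  have M_diag: "peval (M 0) (a *s F 0 0 + b *s F 1 1) = a" "peval (M 1) (a *s F 0 0 + b *s F 1 1) = b" for a b
    by (simp_all add: M_def Y_diag)
  have D_diag: "peval D (a *s F 0 0 + b *s F 1 1) = a * b" for a b
    by (simp add: D_def Y_diag)
  have G_diag: "peval G (a *s F 0 0 + b *s F 1 1) =
      \<tau> 0 0 * a * a + \<tau> 0 1 * a * b + \<tau> 1 0 * b * a + \<tau> 1 1 * b * b" for a b :: complex
    by (simp add: eval_G sum_UNIV_2 L_diag M_diag)
  note diag = L_diag M_diag D_diag G_diag
  have G_00: "peval G (F 0 0) \<noteq> 0"
    using G_diag[of 1 0] \<tau>_nz by simp
  \<comment> \<open>The corner (1:0), (1:0), (1:0) maps to a multiple of \<open>F 0 0\<close>, where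
    all three pairs are seen to be nonzero.\<close>
  let ?e = "axis 0 1 :: complex^2"
  define c where "c = complex_of_real (w 0 0 0 * h 0 0 0)"
  have "c \<noteq> 0"
    using w_nz h_nz by (simp add: c_def)
  have base: "?\<phi> ?e ?e ?e = c *s F 0 0 + 0 *s F 1 1"
    by (simp add: trilinear_axis P_0 cvec_scaleR c_def vector_smult_assoc)
  have "pair_eval A (?\<phi> ?e ?e ?e) $ 0 = c / \<alpha> $ 0"
    by (simp only: base pair_eval_def vec_lambda_beta eval_A diag)
  then have A_nz: "pair_eval A (?\<phi> ?e ?e ?e) \<noteq> 0"
    using \<open>c \<noteq> 0\<close> nz by (metis divide_eq_0_iff of_real_eq_0_iff zero_index)
  have "pair_eval B (?\<phi> ?e ?e ?e) $ 0 = c / \<beta> $ 0"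
    by (simp only: base pair_eval_def vec_lambda_beta eval_B diag)
  then have B_nz: "pair_eval B (?\<phi> ?e ?e ?e) \<noteq> 0"
    using \<open>c \<noteq> 0\<close> nz by (metis divide_eq_0_iff of_real_eq_0_iff zero_index)
  have "pair_eval C (?\<phi> ?e ?e ?e) $ 0 = \<tau> 0 0 * c * c / \<gamma> $ 0"
    using G_diag[of c 0] D_diag[of c 0] by (simp add: base pair_eval_def eval_C)
  then have C_nz: "pair_eval C (?\<phi> ?e ?e ?e) \<noteq> 0"
    using \<open>c \<noteq> 0\<close> nz \<tau>_nz by (metis divide_eq_0_iff mult_eq_0_iff of_real_eq_0_iff zero_index)
  have "(\<Sum>i\<in>UNIV. peval (\<Lambda> i) (F 0 0)) = 1"
    using L_diag[of 1 0] by (simp add: sum_UNIV_2)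
  then have "?\<phi> (pair_eval A (F 0 0)) (pair_eval B (F 0 0)) (pair_eval C (F 0 0)) = peval G (F 0 0) *s F 0 0"
    by (simp add: right)
  moreover have "f 0 0 \<noteq> 0"
    using dual[of 0 0 0 0] by auto
  ultimately have "?\<phi> (pair_eval A (F 0 0)) (pair_eval B (F 0 0)) (pair_eval C (F 0 0)) \<noteq> 0"
    using G_00 by (simp add: vector_mul_eq_0)
  moreover have "proportional (?\<phi> (pair_eval A x) (pair_eval B x) (pair_eval C x)) x" for x
    by (simp add: right proportional_def mult_ac)
  ultimately have "is_inverse w P A B C"
    unfolding is_inverse_def using A_nz B_nz C_nz left by blast
  moreover have "reduced_pair 1 A"
    unfolding reduced_pair_def
  proof (intro conjI allI impI)
    show hom: "homogeneous 1 (A i)" for i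
      unfolding A_def by (intro homogeneous_scale homogeneous_forms)
    have "peval (A 0) (1 *s F 0 0 + 0 *s F 1 1) \<noteq> 0"
      using nz \<tau>_nz unfolding eval_A diag by simp
    then have "A 0 \<noteq> 0"
      by auto
    moreover have "a = 0 \<and> b = 0" if "peval (A 0) (a *s F 0 0 + b *s F 1 1) = 0"
        "peval (A 1) (a *s F 0 0 + b *s F 1 1) = 0" for a b
      using that nz \<tau>_nz unfolding eval_A diag by simp
    moreover fix k assume "k dvd A 0" "k dvd A 1"
    ultimately show "k dvd 1"
      by (rule homogeneous_coprime[OF hom hom])
  qed
  moreover have "reduced_pair 1 B"
    unfolding reduced_pair_def
  proof (intro conjI allI impI)
    show hom: "homogeneous 1 (B i)" for i
      unfolding B_def by (intro homogeneous_scale homogeneous_forms)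
    have "peval (B 0) (1 *s F 0 0 + 0 *s F 1 1) \<noteq> 0"
      using nz \<tau>_nz unfolding eval_B diag by simp
    then have "B 0 \<noteq> 0"
      by auto
    moreover have "a = 0 \<and> b = 0" if "peval (B 0) (a *s F 0 0 + b *s F 1 1) = 0"
        "peval (B 1) (a *s F 0 0 + b *s F 1 1) = 0" for a b
      using that nz \<tau>_nz unfolding eval_B diag by simp
    moreover fix k assume "k dvd B 0" "k dvd B 1"
    ultimately show "k dvd 1"
      by (rule homogeneous_coprime[OF hom hom])
  qed
  moreover have "reduced_pair 2 C"
    unfolding reduced_pair_def
  proof (intro conjI allI impI)
    show hom: "homogeneous 2 (C i)" for i
      unfolding C_def by (auto intro!: homogeneous_scale homogeneous_diff homogeneous_forms)
    have "peval (C 0) (1 *s F 0 0 + 0 *s F 1 1) \<noteq> 0"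
      using nz \<tau>_nz unfolding eval_C diag by simp
    then have "C 0 \<noteq> 0"
      by auto
    \<comment> \<open>A zero of \<open>D\<close> has a = 0 or b = 0; then \<open>G\<close> reduces
      to a nonzero multiple of the square of the other coordinate.\<close>
    moreover have "a = 0 \<and> b = 0" if "peval (C 0) (a *s F 0 0 + b *s F 1 1) = 0"
        "peval (C 1) (a *s F 0 0 + b *s F 1 1) = 0" for a b
      using that nz \<tau>_nz unfolding eval_C diag by auto
    moreover fix k assume "k dvd C 0" "k dvd C 1"
    ultimately show "k dvd 1"
      by (rule homogeneous_coprime[OF hom hom])
  qed
  ultimately show ?thesis
    by (auto simp: birational_of_type_def)
qed

end

subsection \<open>Planes, lines and dual bases\<close>

lemma ex_other_2: "\<exists>k::2. k \<noteq> i"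
  by (metis zero_neq_one)

lemma neq_2_iff: "i \<noteq> j \<longleftrightarrow> i = 0 \<and> j = 1 \<or> i = 1 \<and> j = (0::2)"
proof -
  have "\<forall>i j :: 2. i \<noteq> j \<longleftrightarrow> i = 0 \<and> j = 1 \<or> i = 1 \<and> j = 0"
    unfolding all_2 by simp
  then show ?thesis by blast
qed

lemma eq_2_cases: "i \<noteq> j \<Longrightarrow> k = i \<or> k = (j::2)"
  using neq_2_iff[of i j] neq_2_iff[of k 0] by auto

lemma plane_of_eq_zero_locus: "plane_of p = zero_locus (linear_form (cvec p))"
  by (simp add: plane_of_def zero_locus_def peval_linear_form)

lemma cvec_in_plane_of_iff: "cvec x \<in> plane_of p \<longleftrightarrow> x \<noteq> 0 \<and> p \<bullet> x = 0"
  by (simp add: plane_of_eq_zero_locus zero_locus_def peval_linear_form_cvec)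

lemma zariski_closure_subset_zero_locus:
  assumes "homogeneous d F" "\<And>x. x \<in> X \<Longrightarrow> peval F x = 0"
  shows "zariski_closure X \<subseteq> zero_locus F"
  using assms by (auto simp: zariski_closure_def zero_locus_def)

lemma smooth_surface_in_plane:
  assumes "smooth_surface V" "V \<subseteq> plane_of p" "p \<noteq> 0"
  shows "V = plane_of p"
proof -
  obtain d F where "homogeneous d F" "irreducible F" "V = zero_locus F"
    using assms(1) by (auto simp: smooth_surface_def)
  then show ?thesis
    using irreducible_zero_locus_within_plane[of d F "cvec p"] assms by (simp add: plane_of_eq_zero_locus)
qed

text \<open>An irreducible equation with zeros inside a plane has degree 1, not 2.\<close>

lemma quadric_not_in_plane:
  assumes "quadric V" "p \<noteq> 0"
  shows "\<not> V \<subseteq> plane_of p"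
proof
  assume "V \<subseteq> plane_of p"
  moreover obtain F where "homogeneous 2 F" "irreducible F" "V = zero_locus F"
    using assms(1) by (auto simp: quadric_def)
  ultimately have "(2::nat) = 1"
    using irreducible_zero_locus_within_plane[of 2 F "cvec p"] assms(2)
    by (simp add: plane_of_eq_zero_locus)
  then show False by simp
qed

lemma peval_linear_form_trilinear:
  "peval (linear_form (cvec p)) (trilinear w P s t u) =
    (\<Sum>i\<in>UNIV. \<Sum>j\<in>UNIV. \<Sum>k\<in>UNIV.
      s $ i * t $ j * u $ k * complex_of_real (w i j k * (p \<bullet> P i j k)))"
  by (simp add: trilinear_def linear_form_linear peval_linear_form_cvec mult_ac)

section \<open>Boundary surfaces contained in planes\<close>

text \<open>A linear form vanishing at the control points of a face vanishes on its parametrisation,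
  hence on the Zariski closure.\<close>

lemma Sigma_surf_subset_plane:
  assumes "\<And>j k. p \<bullet> P i j k = 0"
  shows "Sigma_surf w P i \<subseteq> plane_of p"
proof -
  have "peval (linear_form (cvec p)) (trilinear w P (axis i 1) t u) = 0" for t u
    unfolding peval_linear_form_trilinear by (intro sum.neutral ballI) (auto simp: axis_def assms)
  then show ?thesis
    unfolding Sigma_surf_def plane_of_eq_zero_locus
    by (intro zariski_closure_subset_zero_locus[OF homogeneous_linear_form]) auto
qed

lemma T_surf_subset_plane:
  assumes "\<And>i k. p \<bullet> P i j k = 0"
  shows "T_surf w P j \<subseteq> plane_of p"
proof -
  have "peval (linear_form (cvec p)) (trilinear w P s (axis j 1) u) = 0" for s u
    unfolding peval_linear_form_trilinear by (intro sum.neutral ballI) (auto simp: axis_def assms)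
  then show ?thesis
    unfolding T_surf_def plane_of_eq_zero_locus
    by (intro zariski_closure_subset_zero_locus[OF homogeneous_linear_form]) auto
qed

text \<open>Weighted points are used here because weights are not yet known to be nonzero; this
  version is what will prove that they are.\<close>

lemma Y_surf_subset_plane:
  assumes "\<And>i j. p \<bullet> (w i j k *\<^sub>R P i j k) = 0"
  shows "Y_surf w P k \<subseteq> plane_of p"
proof -
  have "w i j k * (p \<bullet> P i j k) = 0" for i j
    using assms[of i j] by simp
  then have "peval (linear_form (cvec p)) (trilinear w P s t (axis k 1)) = 0" for s t
    unfolding peval_linear_form_trilinear by (intro sum.neutral ballI) (auto simp: axis_def)
  then show ?thesis
    unfolding Y_surf_def plane_of_eq_zero_locus
    by (intro zariski_closure_subset_zero_locus[OF homogeneous_linear_form]) auto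
qed

lemma is_line_join_imp_neq:
  assumes "is_line (join p q)"
  shows "p \<noteq> q"
proof
  assume "p = q"
  obtain W where W: "vec.subspace W" "vec.dim W = 2" "join p q = W - {0}"
    using assms by (auto simp: is_line_def)
  have "W = vec.span {cvec p}"
    using W(1,3) \<open>p = q\<close> vec.subspace_0[OF W(1)] vec.span_zero[of "{cvec p}"]
    by (auto simp: join_def)
  then have "vec.dim W \<le> card {cvec p}"
    using vec.dim_le_card[of W "{cvec p}"] by simp
  then show False
    using W(2) by simp
qed

text \<open>First coordinates equal to 1 turn the combinations into affine ones, so distinctness of
  \<open>x\<close> and \<open>y\<close> gives an invertible change of basis, of determinant
  \<open>a - c\<close>.\<close>

lemma join_eqI:
  assumes x: "x = a *\<^sub>R p + b *\<^sub>R q" and y: "y = c *\<^sub>R p + d *\<^sub>R q"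
    and "p $ 0 = 1" "q $ 0 = 1" "x $ 0 = 1" "y $ 0 = 1" "x \<noteq> y"
  shows "join x y = join p q"
proof -
  have b: "b = 1 - a" and d: "d = 1 - c"
    using assms by simp_all
  have "a \<noteq> c"
    using x y b d \<open>x \<noteq> y\<close> by auto
  have "(a - c) *\<^sub>R p = (1 - c) *\<^sub>R x + (a - 1) *\<^sub>R y" "(a - c) *\<^sub>R q = (- c) *\<^sub>R x + a *\<^sub>R y"
    by (simp_all add: x y b d vec_eq_iff algebra_simps)
  then have p: "p = inverse (a - c) *\<^sub>R ((1 - c) *\<^sub>R x + (a - 1) *\<^sub>R y)"
    and q: "q = inverse (a - c) *\<^sub>R ((- c) *\<^sub>R x + a *\<^sub>R y)"
    using \<open>a \<noteq> c\<close> by (metis eq_iff_diff_eq_0 left_inverse scaleR_one scaleR_scaleR)+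
  have in_span: "cvec (k *\<^sub>R (m *\<^sub>R v + n *\<^sub>R v')) \<in> vec.span {cvec v, cvec v'}" for k m n v v'
    by (simp add: cvec_add cvec_scaleR vec.span_add vec.span_scale vec.span_base)
  have "{cvec x, cvec y} \<subseteq> vec.span {cvec p, cvec q}"
    using in_span[of 1 a p b q] in_span[of 1 c p d q] x y by simp
  moreover have "cvec p \<in> vec.span {cvec x, cvec y}" "cvec q \<in> vec.span {cvec x, cvec y}"
    by (subst p q, rule in_span)+
  ultimately have "vec.span {cvec x, cvec y} = vec.span {cvec p, cvec q}"
    unfolding vec.span_eq by simp
  then show ?thesis
    by (simp add: join_def)
qed

text \<open>The apex is given only as a complex point. Its real and imaginary parts lie in all the
  real spans, and one of them is nonzero.\<close>

lemma real_point_of_concurrent_joins: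
  assumes "\<And>i j. A \<in> join (p i j) (q i j)"
  shows "\<exists>a. a \<noteq> 0 \<and> (\<forall>i j. \<exists>x y. a = x *\<^sub>R p i j + y *\<^sub>R q i j)"
proof -
  define re where "re = (\<chi> n. Re (A $ n))"
  define im where "im = (\<chi> n. Im (A $ n))"
  have "(\<exists>x y. re = x *\<^sub>R p i j + y *\<^sub>R q i j) \<and> (\<exists>x y. im = x *\<^sub>R p i j + y *\<^sub>R q i j)" for i j
  proof -
    obtain x y where "A = y *s cvec (q i j) + x *s cvec (p i j)"
      using assms[of i j] by (auto simp: join_def vec.span_insert diff_eq_eq)
    then have "re = Re x *\<^sub>R p i j + Re y *\<^sub>R q i j" "im = Im x *\<^sub>R p i j + Im y *\<^sub>R q i j"
      by (simp_all add: re_def im_def vec_eq_iff)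
    then show ?thesis by blast
  qed
  moreover have "re \<noteq> 0 \<or> im \<noteq> 0"
    using assms[of undefined undefined] by (auto simp: join_def re_def im_def vec_eq_iff complex_eq_iff)
  ultimately show ?thesis by metis
qed

section \<open>Dual bases\<close>

text \<open>The three vectors other than \<open>v i j\<close> lie in a hyperplane. Its normal is not
  orthogonal to \<open>v i j\<close>, by the spanning hypothesis, and can be rescaled.\<close>

lemma dual_basis:
  fixes v :: "2 \<Rightarrow> 2 \<Rightarrow> real^4"
  assumes span: "\<And>a. (\<And>i j. a \<bullet> v i j = 0) \<Longrightarrow> a = 0"
  obtains g where "\<And>i j k l. g i j \<bullet> v k l = (if i = k \<and> j = l then 1 else 0)"
proof -
  have "\<exists>a. \<forall>k l. a \<bullet> v k l = (if i = k \<and> j = l then 1 else 0)" for i j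
  proof -
    let ?S = "(\<lambda>(k, l). v k l) ` (UNIV - {(i, j)})"
    have "dim ?S \<le> card ?S"
      by (rule dim_le_card[OF span_superset]) simp
    also have "\<dots> \<le> card (UNIV - {(i, j)})"
      by (rule card_image_le) simp
    also have "\<dots> = 3"
      by (simp add: card_Diff_singleton)
    finally have "dim ?S \<noteq> DIM(real^4)"
      by simp
    then have "span ?S \<noteq> UNIV"
      by (metis dim_UNIV dim_span)
    then obtain a where a: "a \<noteq> 0" "span ?S \<subseteq> {x. a \<bullet> x = 0}"
      using span_not_univ_subset_hyperplane by blast
    have others: "a \<bullet> v k l = 0" if "(k, l) \<noteq> (i, j)" for k l
    proof -
      have "v k l \<in> ?S"
        using that by (intro image_eqI[of _ _ "(k, l)"]) auto
      from subsetD[OF a(2) span_base[OF this]] show ?thesis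
        by simp
    qed
    have "a \<bullet> v i j \<noteq> 0"
    proof
      assume "a \<bullet> v i j = 0"
      then have "a \<bullet> v k l = 0" for k l
        using others[of k l] by (cases "(k, l) = (i, j)") auto
      then show False
        using span a(1) by blast
    qed
    then have "\<forall>k l. (a /\<^sub>R (a \<bullet> v i j)) \<bullet> v k l = (if i = k \<and> j = l then 1 else 0)"
      using others by auto
    then show ?thesis by blast
  qed
  then show ?thesis
    using that by metis
qed

text \<open>The vectors satisfying the expansion form a subspace that contains every
  \<open>v i j\<close>.\<close>

lemma dual_basis_expand:
  fixes v g :: "2 \<Rightarrow> 2 \<Rightarrow> real^4"
  assumes span: "\<And>a. (\<And>i j. a \<bullet> v i j = 0) \<Longrightarrow> a = 0"
    and dual: "\<And>i j k l. g i j \<bullet> v k l = (if i = k \<and> j = l then 1 else 0)"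
  shows "x = (\<Sum>i\<in>UNIV. \<Sum>j\<in>UNIV. (g i j \<bullet> x) *\<^sub>R v i j)"
proof -
  define T where "T x = (\<Sum>i\<in>UNIV. \<Sum>j\<in>UNIV. (g i j \<bullet> x) *\<^sub>R v i j)" for x
  let ?E = "{x. x = T x}"
  let ?S = "range (\<lambda>(i, j). v i j)"
  have "T 0 = 0" "T (x + y) = T x + T y" "T (c *\<^sub>R x) = c *\<^sub>R T x" for x y c
    by (simp_all add: T_def inner_add_right scaleR_add_left sum.distrib scaleR_sum_right)
  then have sub: "subspace ?E"
    unfolding subspace_def by simp
  have "v i j \<in> ?E" for i j
  proof -
    have "(\<Sum>k\<in>UNIV. \<Sum>l\<in>UNIV. (g k l \<bullet> v i j) *\<^sub>R v k l) = (\<Sum>k\<in>UNIV. if k = i then v i j else 0)"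
      by (rule sum.cong) (auto simp: dual if_distrib[of "\<lambda>r. r *\<^sub>R _"] cong: if_cong)
    then show ?thesis by (simp add: T_def)
  qed
  then have "span ?S \<subseteq> ?E"
    using sub by (intro span_minimal) auto
  moreover have "span ?S = UNIV"
  proof (rule ccontr)
    assume "span ?S \<noteq> UNIV"
    then obtain a where "a \<noteq> 0" "span ?S \<subseteq> {x. a \<bullet> x = 0}"
      using span_not_univ_subset_hyperplane by blast
    moreover from this have "a \<bullet> v i j = 0" for i j
      using span_base[of "v i j" ?S] by auto
    ultimately show False
      using span by blast
  qed
  ultimately show ?thesis
    unfolding T_def by blast
qed

subsection \<open>Reduction to the normal form\<close>

lemma nondegenerate_surfaces:
  assumes "nondegenerate w P"
  shows "smooth_surface (Sigma_surf w P i)" "smooth_surface (T_surf w P j)"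
    "Sigma_surf w P i \<noteq> T_surf w P j"
proof -
  have "\<forall>i j. smooth_surface (Sigma_surf w P i) \<and> smooth_surface (T_surf w P j) \<and>
      Sigma_surf w P i \<noteq> T_surf w P j"
    using assms unfolding nondegenerate_def boundary_surfaces_def all_2 by auto
  then show "smooth_surface (Sigma_surf w P i)" "smooth_surface (T_surf w P j)"
    "Sigma_surf w P i \<noteq> T_surf w P j"
    by blast+
qed

lemma nondegenerate_lines:
  assumes "nondegenerate w P"
  shows "is_line (t_line P i k)" "t_line P i k \<noteq> u_line P i j"
proof -
  have "\<forall>i j k. is_line (t_line P i k) \<and> t_line P i k \<noteq> u_line P i j"
    using assms unfolding nondegenerate_def boundary_lines_def all_2 by auto
  then show "is_line (t_line P i k)" "t_line P i k \<noteq> u_line P i j"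
    by blast+
qed

lemma nondegenerate_neq:
  assumes "nondegenerate w P" "j \<noteq> j'"
  shows "P i j k \<noteq> P i j' k"
proof -
  have "P i 0 k \<noteq> P i 1 k"
    using nondegenerate_lines(1)[OF assms(1), of i k] is_line_join_imp_neq unfolding t_line_def by blast
  then show ?thesis
    using assms(2) unfolding neq_2_iff by auto
qed

text \<open>If the apex were \<open>P i j k\<close>, then for \<open>j' \<noteq> j\<close> both \<open>P i j k\<close> and \<open>P i j' k\<close> would lie on
  \<open>u_line P i j'\<close>, so a \<open>t\<close>-line would coincide with a \<open>u\<close>-line.\<close>

lemma apex_not_control_point:
  assumes P0: "\<And>i j k. P i j k $ 0 = 1" and nd: "nondegenerate w P"
    and "a \<noteq> 0" and a: "\<And>i j. \<exists>x y. a = x *\<^sub>R P i j 0 + y *\<^sub>R P i j 1"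
  shows "a \<noteq> c *\<^sub>R P i j k"
proof
  assume a_eq: "a = c *\<^sub>R P i j k"
  then have "c \<noteq> 0"
    using \<open>a \<noteq> 0\<close> by auto
  obtain j' where "j' \<noteq> j"
    using ex_other_2 by blast
  obtain x y where "a = x *\<^sub>R P i j' 0 + y *\<^sub>R P i j' 1"
    using a by blast
  moreover have "P i j k = inverse c *\<^sub>R a"
    using a_eq \<open>c \<noteq> 0\<close> by simp
  ultimately have corner: "P i j k = (inverse c * x) *\<^sub>R P i j' 0 + (inverse c * y) *\<^sub>R P i j' 1"
    by (simp add: scaleR_add_right)
  have "\<exists>x y. P i j' k = x *\<^sub>R P i j' 0 + y *\<^sub>R P i j' 1"
  proof (cases "k = 0")
    case True
    then show ?thesis
      by (intro exI[of _ 1] exI[of _ 0]) simp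
  next
    case False
    then have "k = 1"
      using eq_2_cases[of 0 1 k] by simp
    then show ?thesis
      by (intro exI[of _ 0] exI[of _ 1]) simp
  qed
  then obtain x' y' where corner': "P i j' k = x' *\<^sub>R P i j' 0 + y' *\<^sub>R P i j' 1"
    by blast
  have neq: "P i j k \<noteq> P i j' k"
    using nondegenerate_neq[OF nd not_sym[OF \<open>j' \<noteq> j\<close>]] .
  \<comment> \<open>Both orders are needed: \<open>t_line\<close> joins index 0 to index 1, and
    \<open>j\<close> may be either.\<close>
  have "join (P i j k) (P i j' k) = u_line P i j'" "join (P i j' k) (P i j k) = u_line P i j'"
    unfolding u_line_def
    by (rule join_eqI[OF corner corner' P0 P0 P0 P0 neq])
      (rule join_eqI[OF corner' corner P0 P0 P0 P0 neq[symmetric]])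
  moreover have "t_line P i k = join (P i j k) (P i j' k) \<or> t_line P i k = join (P i j' k) (P i j k)"
    using \<open>j' \<noteq> j\<close> unfolding t_line_def neq_2_iff by auto
  ultimately show False
    using nondegenerate_lines(2)[OF nd] by metis
qed

lemma Y_quadric_spanning:
  assumes "quadric (Y_surf w P k)" "\<And>i j. a \<bullet> (w i j k *\<^sub>R P i j k) = 0"
  shows "a = 0"
  using Y_surf_subset_plane[of a w k P] quadric_not_in_plane assms by blast

text \<open>The four weighted points have a dual basis, so none of them is zero.\<close>

lemma Y_quadric_weight_nonzero:
  assumes "quadric (Y_surf w P k)"
  shows "w i j k \<noteq> 0"
proof -
  obtain g where "\<And>i j l m. g i j \<bullet> (w l m k *\<^sub>R P l m k) = (if i = l \<and> j = m then 1 else 0)"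
    using dual_basis[of "\<lambda>i j. w i j k *\<^sub>R P i j k"] Y_quadric_spanning[OF assms] by metis
  from this[of i j i j] show ?thesis by auto
qed

text \<open>If a coordinate of the apex vanished, \<open>g i j\<close> would kill all control points
  except \<open>P i j 0\<close> and \<open>P i j 1\<close>; its plane would be both a \<Sigma> and a
  T.\<close>

lemma apex_coordinates_nonzero:
  assumes nd: "nondegenerate w P"
    and dual: "\<And>i j k l. g i j \<bullet> P k l 0 = (if i = k \<and> j = l then 1 else 0)"
    and P_1: "\<And>i j. \<exists>c d. P i j 1 = c *\<^sub>R P i j 0 + d *\<^sub>R a"
  shows "g i j \<bullet> a \<noteq> 0"
proof
  assume "g i j \<bullet> a = 0"
  then have "g i j \<bullet> P k l 1 = 0" if "\<not> (k = i \<and> l = j)" for k l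
    using P_1[of k l] that by (auto simp: inner_add_right dual)
  then have zero: "g i j \<bullet> P k l m = 0" if "\<not> (k = i \<and> l = j)" for k l m
    using that dual[of i j k l] eq_2_cases[of 0 1 m] by auto
  have "g i j \<noteq> 0"
    using dual[of i j i j] by auto
  obtain i' j' where "i' \<noteq> i" "j' \<noteq> j"
    using ex_other_2 by metis
  then have "Sigma_surf w P i' = plane_of (g i j)" "T_surf w P j' = plane_of (g i j)"
    using nondegenerate_surfaces[OF nd] \<open>g i j \<noteq> 0\<close> zero
    by (intro smooth_surface_in_plane Sigma_surf_subset_plane T_surf_subset_plane; simp)+
  then show False
    using nondegenerate_surfaces(3)[OF nd, of i' j'] by simp
qed

text \<open>The quadric with k = 0 makes the points \<open>P i j 0\<close> a basis. Apex coordinates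
  then give the planes explicitly, and the two lines in the plane of \<open>p\<close> fix the
  signs.\<close>

lemma pyramid_normal_form_exists:
  fixes p :: "real^4"
  assumes P0: "\<And>i j k. P i j k $ 0 = 1"
    and nd: "nondegenerate w P"
    and pyr: "pyramidal_u w P"
    and "p \<noteq> 0"
    and s: "Sigma_surf w P 0 \<inter> Sigma_surf w P 1 \<subseteq> plane_of p"
    and t: "T_surf w P 0 \<inter> T_surf w P 1 \<subseteq> plane_of p"
  shows "\<exists>f g \<tau>. pyramid_normal_form w (\<lambda>i j k. p \<bullet> P i j k) P f g \<tau>"
proof -
  have quad: "quadric (Y_surf w P k)" for k
    using pyr by (simp add: pyramidal_u_def)
  have w_nz: "w i j k \<noteq> 0" for i j k
    by (rule Y_quadric_weight_nonzero[OF quad])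
  have span: "b = 0" if "\<And>i j. b \<bullet> P i j 0 = 0" for b
    using Y_quadric_spanning[OF quad, of b 0] that by simp
  obtain g where dual: "\<And>i j k l. g i j \<bullet> P k l 0 = (if i = k \<and> j = l then 1 else 0)"
    using dual_basis[of "\<lambda>i j. P i j 0"] span by metis
  note expand = dual_basis_expand[of "\<lambda>i j. P i j 0" g, OF span dual]
  obtain A where "\<And>i j. A \<in> u_line P i j"
    using pyr by (auto simp: pyramidal_u_def)
  then obtain a where "a \<noteq> 0" and a: "\<And>i j. \<exists>x y. a = x *\<^sub>R P i j 0 + y *\<^sub>R P i j 1"
    using real_point_of_concurrent_joins[of A "\<lambda>i j. P i j 0" "\<lambda>i j. P i j 1"]
    unfolding u_line_def by blast
  note a_neq = apex_not_control_point[OF P0 nd \<open>a \<noteq> 0\<close> a]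
  have "\<exists>c d. P i j 1 = c *\<^sub>R P i j 0 + d *\<^sub>R a \<and> c \<noteq> 0 \<and> d \<noteq> 0" for i j
  proof -
    obtain x y where xy: "a = x *\<^sub>R P i j 0 + y *\<^sub>R P i j 1"
      using a by blast
    \<comment> \<open>A zero coefficient would make the apex a multiple of a control point.\<close>
    have "x \<noteq> 0" "y \<noteq> 0"
      using xy a_neq[of y i j 1] a_neq[of x i j 0] by auto
    then show ?thesis
      by (intro exI[of _ "- x / y"] exI[of _ "1 / y"]) (simp add: xy scaleR_add_right)
  qed
  then obtain c d where P_1: "\<And>i j. P i j 1 = c i j *\<^sub>R P i j 0 + d i j *\<^sub>R a"
    and cd: "\<And>i j. c i j \<noteq> 0" "\<And>i j. d i j \<noteq> 0"
    by metis
  have a_nz: "g i j \<bullet> a \<noteq> 0" for i j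
    by (rule apex_coordinates_nonzero[OF nd dual]) (use P_1 in blast)
  \<comment> \<open>The components of the apex in the basis \<open>P i j 0\<close>; the apex is
    their sum, and \<open>e\<close> below is their dual basis.\<close>
  define b where "b i j = (g i j \<bullet> a) *\<^sub>R P i j 0" for i j
  have g_b: "g i j \<bullet> b k l = (if i = k \<and> j = l then g i j \<bullet> a else 0)" for i j k l
    by (simp add: b_def dual)
  have a_b: "a = b 0 0 + b 0 1 + b 1 0 + b 1 1"
    using expand[of a] by (simp add: sum_UNIV_2 b_def add.assoc)
  define e where "e i j = g i j /\<^sub>R (g i j \<bullet> a)" for i j
  have e_P: "e i j \<bullet> P k l 0 = (if i = k \<and> j = l then inverse (g i j \<bullet> a) else 0)" for i j k l
    by (simp add: e_def dual)
  have e_b: "e i j \<bullet> b k l = (if i = k \<and> j = l then 1 else 0)" for i j k l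
    using a_nz by (simp add: e_def g_b)
  have e_a: "e i j \<bullet> a = 1" for i j
    using a_nz by (simp add: e_def)
  have e_neq: "e i j - e k l \<noteq> 0" if "\<not> (i = k \<and> j = l)" for i j k l
  proof
    assume "e i j - e k l = 0"
    then have "(e i j - e k l) \<bullet> b i j = 0" by simp
    then show False
      using that by (auto simp: inner_diff_left e_b)
  qed
  \<comment> \<open>All \<open>e i j\<close> equal 1 on the apex, so a difference kills it, together
    with the points of the opposite face.\<close>
  have Sigma: "Sigma_surf w P i = plane_of (e i' 0 - e i' 1)" if "i \<noteq> i'" for i i'
  proof -
    have "(e i' 0 - e i' 1) \<bullet> P i j k = 0" for j k
      using that eq_2_cases[of 0 1 k]
      by (auto simp: P_1 inner_diff_left inner_add_right e_P e_a)
    then show ?thesis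
      using nondegenerate_surfaces(1)[OF nd] e_neq
      by (intro smooth_surface_in_plane Sigma_surf_subset_plane) auto
  qed
  have T: "T_surf w P j = plane_of (e 0 j' - e 1 j')" if "j \<noteq> j'" for j j'
  proof -
    have "(e 0 j' - e 1 j') \<bullet> P i j k = 0" for i k
      using that eq_2_cases[of 0 1 k]
      by (auto simp: P_1 inner_diff_left inner_add_right e_P e_a)
    then show ?thesis
      using nondegenerate_surfaces(2)[OF nd] e_neq
      by (intro smooth_surface_in_plane T_surf_subset_plane) auto
  qed
  have b_neq: "b i j + b k l \<noteq> 0" if "\<not> (i = k \<and> j = l)" for i j k l
  proof
    assume "b i j + b k l = 0"
    then have "e i j \<bullet> (b i j + b k l) = 0" by simp
    then show False
      using that by (auto simp: inner_add_right e_b)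
  qed
  \<comment> \<open>Each \<open>b i 0 + b i 1\<close> satisfies both plane equations, so it lies on
    the line s.\<close>
  have on_s: "p \<bullet> (b i 0 + b i 1) = 0" for i
  proof -
    have "b i 0 + b i 1 \<noteq> 0"
      by (rule b_neq) simp
    moreover have "(e k 0 - e k 1) \<bullet> (b i 0 + b i 1) = 0" for k
      by (simp add: inner_diff_left inner_add_right e_b)
    ultimately have "cvec (b i 0 + b i 1) \<in> Sigma_surf w P 0 \<inter> Sigma_surf w P 1"
      by (simp add: Sigma[of 0 1] Sigma[of 1 0] cvec_in_plane_of_iff)
    then show ?thesis
      using s by (auto simp: cvec_in_plane_of_iff)
  qed
  have on_t: "p \<bullet> (b 0 j + b 1 j) = 0" for j
  proof -
    have "b 0 j + b 1 j \<noteq> 0"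
      by (rule b_neq) simp
    moreover have "(e 0 k - e 1 k) \<bullet> (b 0 j + b 1 j) = 0" for k
      by (simp add: inner_diff_left inner_add_right e_b)
    ultimately have "cvec (b 0 j + b 1 j) \<in> T_surf w P 0 \<inter> T_surf w P 1"
      by (simp add: T[of 0 1] T[of 1 0] cvec_in_plane_of_iff)
    then show ?thesis
      using t by (auto simp: cvec_in_plane_of_iff)
  qed
  define q where "q = p \<bullet> b 0 0"
  \<comment> \<open>Sums along rows and columns vanish, which forces alternating signs and fixes
    \<open>p\<close> up to the scalar \<open>q\<close>. The apex therefore lies in the plane of
    \<open>p\<close>.\<close>
  have p_b: "p \<bullet> b i j = (if i = j then q else - q)" for i j
  proof -
    have "\<forall>i j. p \<bullet> b i j = (if i = j then q else - q)"
      using on_s[of 0] on_s[of 1] on_t[of 0] unfolding all_2 q_def inner_add_right by simp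
    then show ?thesis by blast
  qed
  have p_a: "p \<bullet> a = 0"
    unfolding a_b inner_add_right p_b by simp
  have "q \<noteq> 0"
  proof
    assume "q = 0"
    then have "(g i j \<bullet> a) * (p \<bullet> P i j 0) = 0" for i j
      using p_b[of i j] by (simp add: b_def split: if_splits)
    then have "p \<bullet> P i j 0 = 0" for i j
      using a_nz by (metis mult_eq_0_iff)
    then show False
      using span \<open>p \<noteq> 0\<close> by blast
  qed
  have h_0: "p \<bullet> P i j 0 \<noteq> 0" for i j
  proof
    assume "p \<bullet> P i j 0 = 0"
    then have "p \<bullet> b i j = 0" by (simp add: b_def)
    then show False
      using \<open>q \<noteq> 0\<close> p_b[of i j] by (simp split: if_splits)
  qed
  have h_1: "p \<bullet> P i j 1 = c i j * (p \<bullet> P i j 0)" for i j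
    by (simp add: P_1 inner_add_right p_a)
  \<comment> \<open>This scaling gives every \<open>f i j\<close> the value 1 under \<open>p\<close>
    and turns the components of the apex into \<open>q\<close> times a sign.\<close>
  define f where "f i j = P i j 0 /\<^sub>R (p \<bullet> P i j 0)" for i j
  have P_f: "P i j 0 = (p \<bullet> P i j 0) *\<^sub>R f i j" for i j
    using h_0 by (simp add: f_def)
  have b_f: "b i j = (if i = j then q else - q) *\<^sub>R f i j" for i j
    unfolding p_b[symmetric] using h_0[of i j] by (simp add: b_def f_def)
  have a_f: "a = q *\<^sub>R (f 0 0 - f 0 1 - f 1 0 + f 1 1)"
    unfolding a_b b_f by (simp add: algebra_simps)
  define g' where "g' i j = (p \<bullet> P i j 0) *\<^sub>R g i j" for i j
  \<comment> \<open>Forced by dividing \<open>P i j 1\<close> by its value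
    \<open>c i j * (p \<bullet> P i j 0)\<close> under \<open>p\<close>; the factor \<open>q\<close>
    comes from \<open>a_f\<close>.\<close>
  define \<tau> where "\<tau> i j = d i j * q / (c i j * (p \<bullet> P i j 0))" for i j
  have "pyramid_normal_form w (\<lambda>i j k. p \<bullet> P i j k) P f g' \<tau>"
  proof
    show "g' i j \<bullet> f k l = (if i = k \<and> j = l then 1 else 0)" for i j k l
      using h_0 by (simp add: g'_def f_def dual)
    show "x = (\<Sum>i\<in>UNIV. \<Sum>j\<in>UNIV. (g' i j \<bullet> x) *\<^sub>R f i j)" for x
    proof -
      have "(g' i j \<bullet> x) *\<^sub>R f i j = (g i j \<bullet> x) *\<^sub>R P i j 0" for i j
        using h_0[of i j] by (simp add: g'_def f_def)
      then show ?thesis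
        using expand[of x] by simp
    qed
    show "P i j 0 = (p \<bullet> P i j 0) *\<^sub>R f i j" for i j
      by (rule P_f)
    show "P i j 1 = (p \<bullet> P i j 1) *\<^sub>R (f i j + \<tau> i j *\<^sub>R (f 0 0 - f 0 1 - f 1 0 + f 1 1))" for i j
    proof -
      have "P i j 1 = (p \<bullet> P i j 1) *\<^sub>R f i j + (d i j * q) *\<^sub>R (f 0 0 - f 0 1 - f 1 0 + f 1 1)"
        using P_1[of i j] P_f[of i j] a_f by (metis h_1 scaleR_scaleR)
      also have "d i j * q = (p \<bullet> P i j 1) * \<tau> i j"
        using cd h_0 by (simp add: h_1 \<tau>_def)
      finally show ?thesis
        by (simp only: scaleR_add_right scaleR_scaleR)
    qed
    show "w i j k \<noteq> 0" for i j k
      by (rule w_nz)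
    show "p \<bullet> P i j k \<noteq> 0" for i j k
      using eq_2_cases[of 0 1 k] h_0 h_1 cd by auto
    show "\<tau> i j \<noteq> 0" for i j
      using cd h_0 \<open>q \<noteq> 0\<close> by (simp add: \<tau>_def)
  qed
  then show ?thesis by blast
qed

theorem corollary4p7:
  fixes w :: "2 \<Rightarrow> 2 \<Rightarrow> 2 \<Rightarrow> real" and P :: "2 \<Rightarrow> 2 \<Rightarrow> 2 \<Rightarrow> real^4" and \<pi>\<^sub>0 :: "real^4"
  assumes "\<And>i j k. P i j k $ 0 = 1"
    and "nondegenerate w P"
    and "pyramidal_u w P"
    and "\<pi>\<^sub>0 \<noteq> 0"
    and "Sigma_surf w P 0 \<inter> Sigma_surf w P 1 \<subseteq> plane_of \<pi>\<^sub>0"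
    and "T_surf w P 0 \<inter> T_surf w P 1 \<subseteq> plane_of \<pi>\<^sub>0"
  shows "birational_of_type w P 1 1 2 \<longleftrightarrow>
    (\<exists>\<alpha> \<beta> \<gamma> :: real^2. \<alpha> \<noteq> 0 \<and> \<beta> \<noteq> 0 \<and> \<gamma> \<noteq> 0 \<and>
      (\<forall>i j k. w i j k = \<alpha> $ i * \<beta> $ j * \<gamma> $ k * (1 / (\<pi>\<^sub>0 \<bullet> P i j k))))"
proof -
  obtain f g \<tau> where "pyramid_normal_form w (\<lambda>i j k. \<pi>\<^sub>0 \<bullet> P i j k) P f g \<tau>"
    using pyramid_normal_form_exists[OF assms] by blast
  then interpret pyramid_normal_form w "\<lambda>i j k. \<pi>\<^sub>0 \<bullet> P i j k" P f g \<tau> .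
  \<comment> \<open>Nonvanishing of \<open>\<pi>\<^sub>0 \<bullet> P i j k\<close> makes \<Delta>
    well defined and lets the denominators be cleared.\<close>
  have "w i j k = v * (1 / (\<pi>\<^sub>0 \<bullet> P i j k)) \<longleftrightarrow> w i j k * (\<pi>\<^sub>0 \<bullet> P i j k) = v" for i j k v
    using h_nz[of i j k] by (auto simp: field_simps)
  then show ?thesis
    using birational_imp_weights weights_imp_birational by auto
qed

end
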